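(* Let $1<p<2$. There exist constants $\varepsilon_0>0$, $C>0$ and $\gamma>0$, depending only on $N$ and $p$ (in particular independent of $\varepsilon$), such that the following holds. Let $R>0$ and $0<\varepsilon<\varepsilon_0R$, let $f:B_R\to\mathbb{R}$ be a bounded Borel measurable function, and let $u:B_{R+\varepsilon}\to\mathbb{R}$ be a bounded Borel measurable function satisfying $$u(x)=\frac12\Big(\sup_{|z|=1}\mathcal{I}^z_\varepsilon u(x)+\inf_{|z|=1}\mathcal{I}^z_\varepsilon u(x)\Big)+\varepsilon^2 f(x)\quad\text{for all }x\in B_R .$$ Then $$|u(x)-u(y)|\le\frac{C}{R^\gamma}\Big(\sup_{B_R}|u|+R^2\sup_{B_R}|f|\Big)\big(|x-y|^\gamma+\varepsilon^\gamma\big)$$ for every $x,y\in B_{R/2}$.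
   Context: $N\ge 1$ is an integer, $B_r$ is the open ball of $\mathbb{R}^N$ of radius $r$ centered at the origin, $|B_1|$ is the Lebesgue measure of $B_1$. Write $(t)_+^{p-2}=t^{p-2}$ if $t>0$ and $(t)_+^{p-2}=0$ if $t\le 0$. Let $\gamma_{N,p}=\frac{1}{|B_1|}\int_{B_1}(z\cdot h)_+^{p-2}\,dh$, which is finite and independent of the unit vector $z$. For a bounded Borel measurable function $u$ defined on the ball of radius $\varepsilon$ around $x$, and $z\in\mathbb{R}^N$ with $|z|=1$, $$\mathcal{I}^z_\varepsilon u(x)=\frac{1}{\gamma_{N,p}}\cdot\frac{1}{|B_1|}\int_{B_1}u(x+\varepsilon h)\,(z\cdot h)_+^{p-2}\,dh .$$ Suprema and infima over $|z|=1$ are over all unit vectors $z\in\mathbb{R}^N$. *)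

theory Defs
  imports "HOL-Analysis.Analysis"
begin

definition pos_pow :: "real \<Rightarrow> real \<Rightarrow> real" where
  "pos_pow p t = (if t > 0 then t powr (p - 2) else 0)"

text \<open>The value of \<open>norm_const p z\<close> is the same for all unit vectors \<open>z\<close>, by rotation
  invariance; it is the constant $\gamma_{N,p}$. The vector is kept as an argument, so that no
  representative has to be chosen. The dimension $N$ is \<open>CARD('n)\<close>.\<close>

definition norm_const :: "real \<Rightarrow> real ^ 'n \<Rightarrow> real" where
  "norm_const p z =
     1 / measure lborel (ball (0 :: real ^ 'n) 1) *
     (LINT h : ball 0 1 | lborel. pos_pow p (z \<bullet> h))"

definition dir_avg :: "real \<Rightarrow> real \<Rightarrow> real ^ 'n \<Rightarrow> (real ^ 'n \<Rightarrow> real) \<Rightarrow> real ^ 'n \<Rightarrow> real" where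
  "dir_avg p \<epsilon> z u x =
     1 / norm_const p z * (1 / measure lborel (ball (0 :: real ^ 'n) 1)) *
     (LINT h : ball 0 1 | lborel. u (x + \<epsilon> *\<^sub>R h) * pos_pow p (z \<bullet> h))"

text \<open>A bounded Borel measurable real function on \<open>A\<close>; functions on \<open>A\<close> are represented by total
  functions, whose values outside \<open>A\<close> are left unconstrained.\<close>

definition bounded_borel_on :: "(real ^ 'n) set \<Rightarrow> (real ^ 'n \<Rightarrow> real) \<Rightarrow> bool" where
  "bounded_borel_on A f \<longleftrightarrow>
     f \<in> borel_measurable (restrict_space borel A) \<and> bounded (f ` A)"

end

theory Submission
  imports Defs
begin

text \<open>The estimate holds with exponent \<open>1/2\<close>, by a coupling argument. Subtracting the equations
  at \<open>x\<close> and \<open>y\<close> shows that, up to a source term of order \<open>\<epsilon>\<^sup>2\<close>, \<open>u x - u y\<close> is the average of two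
  differences \<open>I\<^sup>z u x - I\<^sup>w u y\<close>: an adversary picks the unit vectors of the first one, and we then
  pick those of the second. Each difference is the integral of \<open>u (x + \<epsilon> h) - u (y + \<epsilon> P h)\<close> for any
  orthogonal \<open>P\<close> with \<open>P z = w\<close>. So \<open>u x - u y\<close> is compared with
  \<open>C |x - y|\<^bsup>1/2\<^esup> + M |x - x\<^sub>0|\<^sup>2\<close>. Let \<open>e\<close> be the direction of \<open>x - y\<close>.

  If \<open>|x - y|\<close> is large compared with \<open>\<epsilon>\<close> and the adversary does not pull \<open>x\<close> and \<open>y\<close> apart almost
  along \<open>e\<close>, we answer \<open>(-e, e)\<close> and win by the first-order drift. Otherwise we answer \<open>(-z, -w)\<close>; the
  first-order terms cancel, and taking for \<open>P\<close> the reflection which swaps \<open>z\<close> and \<open>w\<close> we win by the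
  concavity of the square root. If \<open>|x - y|\<close> is comparable with \<open>\<epsilon>\<close>, the answer \<open>(-e, e)\<close> brings the
  points closer with a fixed probability, and if \<open>|x - y| \<le> \<epsilon>/2\<close> the distributions of the two steps
  with the same unit vector \<open>e\<close> overlap.\<close>

section \<open>Translations and orthogonal maps preserve Lebesgue measure\<close>

lemma nn_integral_lborel_translate:
  fixes f :: "'a::euclidean_space \<Rightarrow> ennreal"
  assumes [measurable]: "f \<in> borel_measurable borel"
  shows "(\<integral>\<^sup>+x. f (c + x) \<partial>lborel) = (\<integral>\<^sup>+x. f x \<partial>lborel)"
proof -
  have "(\<integral>\<^sup>+x. f x \<partial>lborel) = (\<integral>\<^sup>+x. f x \<partial>distr lborel borel ((+) c))"
    by (simp add: lborel_distr_plus)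
  then show ?thesis by (simp add: nn_integral_distr)
qed

lemma borel_measurable_orthogonal:
  fixes P :: "'a::euclidean_space \<Rightarrow> 'a"
  shows "orthogonal_transformation P \<Longrightarrow> P \<in> borel_measurable borel"
  by (intro borel_measurable_continuous_onI linear_continuous_on linear_conv_bounded_linear[THEN iffD1]
        orthogonal_transformation_linear)

text \<open>The library has this only for index types in \<^class>\<open>wellorder\<close>. Here it follows, as in the
  uniqueness proof for Haar measure, from translation invariance and \<open>P -` B = B\<close> for the unit ball
  \<open>B\<close>, by computing the double integral of \<open>\<lambda>(x, y). indicator A (P x) * indicator B y\<close> in two ways.\<close>

lemma lborel_distr_orthogonal:
  fixes P :: "'a::euclidean_space \<Rightarrow> 'a"
  assumes P: "orthogonal_transformation P"
  shows "distr lborel borel P = lborel"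
proof (rule measure_eqI)
  have [measurable]: "P \<in> borel_measurable borel" by (rule borel_measurable_orthogonal[OF P])
  have lin: "linear P" using P orthogonal_transformation_linear by blast
  define Q where "Q = inv P"
  have PQ: "P (Q y) = y" for y
    unfolding Q_def using orthogonal_transformation_surj[OF P] by (simp add: surj_f_inv_f)
  define B where "B = ball (0::'a) 1"
  have [measurable]: "B \<in> sets borel" by (simp add: B_def)
  have B: "- P x \<in> B \<longleftrightarrow> x \<in> B" for x
    by (simp add: B_def orthogonal_transformation_norm[OF P])
  fix A assume "A \<in> sets (distr lborel borel P)"
  then have [measurable]: "A \<in> sets borel" by simp
  have "emeasure (distr lborel borel P) A = (\<integral>\<^sup>+x. indicator A (P x) \<partial>lborel)"
    by (simp add: nn_integral_distr flip: nn_integral_indicator)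
  then have "emeasure (distr lborel borel P) A * emeasure lborel B
      = (\<integral>\<^sup>+x. (\<integral>\<^sup>+y. indicator A (P x) * indicator B y \<partial>lborel) \<partial>lborel)"
    by (simp add: nn_integral_cmult nn_integral_multc flip: nn_integral_indicator)
  also have "\<dots> = (\<integral>\<^sup>+x. (\<integral>\<^sup>+y. indicator A (P x) * indicator B (- P x + y) \<partial>lborel) \<partial>lborel)"
    by (subst nn_integral_lborel_translate[of "\<lambda>y. indicator A (P _) * indicator B y"]) auto
  also have "\<dots> = (\<integral>\<^sup>+y. (\<integral>\<^sup>+x. indicator A (P x) * indicator B (- P x + y) \<partial>lborel) \<partial>lborel)"
    by (rule lborel_pair.Fubini') measurable
  \<comment> \<open>Translating \<open>x\<close> by \<open>Q y\<close> turns \<open>P x\<close> into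
    \<open>y + P x\<close>, which moves \<open>y\<close> out of the indicator of \<open>B\<close>
    and into that of \<open>A\<close>.\<close>
  also have "\<dots> = (\<integral>\<^sup>+y. (\<integral>\<^sup>+x. indicator A (y + P x) * indicator B (- P x) \<partial>lborel) \<partial>lborel)"
  proof (rule nn_integral_cong)
    fix y :: 'a
    have "(\<integral>\<^sup>+x. indicator A (P x) * indicator B (- P x + y) \<partial>lborel)
        = (\<integral>\<^sup>+x. indicator A (P (Q y + x)) * indicator B (- P (Q y + x) + y) \<partial>lborel)"
      by (rule nn_integral_lborel_translate[symmetric]) measurable
    then show "(\<integral>\<^sup>+x. indicator A (P x) * indicator B (- P x + y) \<partial>lborel)
        = (\<integral>\<^sup>+x. indicator A (y + P x) * indicator B (- P x) \<partial>lborel)"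
      by (simp add: linear_add[OF lin] PQ algebra_simps)
  qed
  also have "\<dots> = (\<integral>\<^sup>+x. (\<integral>\<^sup>+y. indicator A (y + P x) * indicator B (- P x) \<partial>lborel) \<partial>lborel)"
    by (rule lborel_pair.Fubini'[symmetric]) measurable
  also have "\<dots> = (\<integral>\<^sup>+x. emeasure lborel A * indicator B x \<partial>lborel)"
  proof (rule nn_integral_cong)
    fix x :: 'a
    have "(\<integral>\<^sup>+y. indicator A (y + P x) * indicator B (- P x) \<partial>lborel)
      = (\<integral>\<^sup>+y. indicator A y \<partial>lborel) * indicator B (- P x)"
      using nn_integral_lborel_translate[of "indicator A" "P x"] by (simp add: nn_integral_multc add.commute)
    moreover have "(indicator B (- P x) :: ennreal) = indicator B x" by (simp add: B indicator_def)
    ultimately show "(\<integral>\<^sup>+y. indicator A (y + P x) * indicator B (- P x) \<partial>lborel) = emeasure lborel A * indicator B x"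
      by simp
  qed
  also have "\<dots> = emeasure lborel A * emeasure lborel B"
    by (simp add: nn_integral_cmult)
  finally have "emeasure (distr lborel borel P) A * emeasure lborel B = emeasure lborel A * emeasure lborel B" .
  moreover have "emeasure lborel B \<noteq> 0" "emeasure lborel B \<noteq> top"
    using emeasure_lborel_ball_finite[of "0::'a" 1] content_ball_pos[of 1 "0::'a"]
    by (auto simp: B_def measure_def)
  ultimately show "emeasure (distr lborel borel P) A = emeasure lborel A"
    by (metis ennreal_mult_divide_eq)
qed simp

subsection \<open>The one-step distributions\<close>

text \<open>The unnormalised kernel of \<open>dir_avg\<close>, cut off outside the unit ball so that
  all integrals run over the whole space.\<close>

definition weight :: "real \<Rightarrow> real ^ 'n \<Rightarrow> real ^ 'n \<Rightarrow> real" where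
  "weight p z h = indicator (ball 0 1) h * pos_pow p (z \<bullet> h)"

lemma pos_pow_nonneg: "0 \<le> pos_pow p t"
  by (simp add: pos_pow_def)

lemma weight_nonneg: "0 \<le> weight p z h"
  by (simp add: weight_def pos_pow_nonneg)

lemma borel_measurable_pos_pow [measurable]: "pos_pow p \<in> borel_measurable borel"
  unfolding pos_pow_def[abs_def] by measurable

lemma borel_measurable_weight [measurable]: "weight p z \<in> borel_measurable borel"
  unfolding weight_def[abs_def] by (intro borel_measurable_times borel_measurable_indicator
      measurable_compose[OF _ borel_measurable_pos_pow]) auto

lemma weight_orthogonal:
  fixes P :: "real ^ 'n \<Rightarrow> real ^ 'n"
  assumes "orthogonal_transformation P"
  shows "weight p (P z) (P h) = weight p z h"
  using assms by (simp add: weight_def orthogonal_transformation_def indicator_def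
      orthogonal_transformation_norm[OF assms])

lemma weight_integral_orthogonal:
  fixes g :: "real ^ 'n \<Rightarrow> real" and P :: "real ^ 'n \<Rightarrow> real ^ 'n"
  assumes P: "orthogonal_transformation P" and g: "g \<in> borel_measurable borel"
  shows "(LINT h|lborel. weight p (P z) h * g h) = (LINT h|lborel. weight p z h * g (P h))"
proof -
  have [measurable]: "P \<in> borel_measurable borel" by (rule borel_measurable_orthogonal[OF P])
  have "(LINT h|lborel. weight p (P z) h * g h) = (LINT h|distr lborel borel P. weight p (P z) h * g h)"
    by (simp add: lborel_distr_orthogonal[OF P])
  also have "\<dots> = (LINT h|lborel. weight p z h * g (P h))"
    using g by (subst integral_distr) (auto simp: weight_orthogonal[OF P])
  finally show ?thesis .
qed

text \<open>This is where \<open>1 < p\<close> enters: the exponent \<open>p - 2\<close> of the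
  singularity at 0 is above -1.\<close>

lemma nn_integral_pos_pow_interval:
  assumes "1 < p"
  shows "(\<integral>\<^sup>+x. ennreal (indicator {-1..1} x * pos_pow p x) \<partial>lborel) < \<infinity>"
proof -
  have "integrable lebesgue (\<lambda>x::real. indicator {0<..1} x *\<^sub>R (x powr (p - 2)))"
    using assms
    by (intro nonnegative_absolutely_integrable_1[unfolded set_integrable_def] integrable_on_powr_from_0') auto
  then have "integrable lborel (\<lambda>x::real. indicator {0<..1} x *\<^sub>R (x powr (p - 2)))"
    by (subst (asm) integrable_completion) auto
  moreover have "(\<lambda>x::real. indicator {0<..1} x *\<^sub>R (x powr (p - 2))) = (\<lambda>x. indicator {-1..1} x * pos_pow p x)"
    by (auto simp: pos_pow_def indicator_def fun_eq_iff)
  ultimately have "integrable lborel (\<lambda>x::real. indicator {-1..1} x * pos_pow p x)"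
    by simp
  moreover have "norm (indicator {-1..1} x * pos_pow p x) = indicator {-1..1} x * pos_pow p x" for x :: real
    by (simp add: abs_mult pos_pow_nonneg)
  ultimately show ?thesis
    unfolding integrable_iff_bounded by simp
qed

text \<open>The unit ball lies in a cube, and there the kernel is singular in coordinate
  \<open>k\<close> only. Tonelli splits the majorant into one-dimensional integrals, only one of
  which is not trivial.\<close>

lemma weight_axis_integrable:
  assumes "1 < p"
  shows "integrable lborel (weight p (axis k 1 :: real ^ 'n))"
proof (rule integrableI_bounded)
  let ?f = "\<lambda>b::real^'n. \<lambda>x::real. ennreal (indicator {-1..1} x * (if b = axis k 1 then pos_pow p x else 1))"
  have "(\<integral>\<^sup>+h. ennreal (norm (weight p (axis k 1 :: real ^ 'n) h)) \<partial>lborel)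
      \<le> (\<integral>\<^sup>+h. (\<Prod>b\<in>Basis. ?f b (h \<bullet> b)) \<partial>lborel)"
  proof (rule nn_integral_mono)
    fix h :: "real ^ 'n"
    have ax: "axis k (1::real) \<in> (Basis :: (real^'n) set)" by (auto simp: Basis_vec_def)
    show "ennreal (norm (weight p (axis k 1) h)) \<le> (\<Prod>b\<in>Basis. ?f b (h \<bullet> b))"
    proof (cases "norm h < 1")
      case True
      then have *: "\<bar>h \<bullet> b\<bar> \<le> 1" if "b \<in> Basis" for b
        using Basis_le_norm[OF that, of h] by linarith
      have "(\<Prod>b\<in>Basis. ?f b (h \<bullet> b)) = (\<Prod>b\<in>Basis. if b = axis k 1 then ennreal (pos_pow p (h \<bullet> b)) else 1)"
        using * by (intro prod.cong) (auto simp: abs_le_iff indicator_def)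
      also have "\<dots> = ennreal (pos_pow p (h \<bullet> axis k 1))"
        using ax by (simp add: prod.delta)
      finally show ?thesis
        by (auto simp: weight_def pos_pow_nonneg inner_commute indicator_def)
    qed (simp add: weight_def)
  qed
  also have "\<dots> = (\<Prod>b\<in>Basis. \<integral>\<^sup>+x. ?f b x \<partial>lborel)"
    by (rule nn_integral_lborel_prod) auto
  also have "\<dots> < \<infinity>"
    proof -
    have "(\<integral>\<^sup>+x. ?f b x \<partial>lborel) \<noteq> top" for b :: "real ^ 'n"
      using nn_integral_pos_pow_interval[OF assms]
      by (cases "b = axis k 1") (auto simp: ennreal_indicator)
    then show ?thesis by (simp add: ennreal_prod_eq_top flip: less_top)
  qed
  finally show "(\<integral>\<^sup>+h. ennreal (norm (weight p (axis k 1 :: real ^ 'n) h)) \<partial>lborel) < \<infinity>" .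
qed simp

lemma ex_orthogonal_axis:
  fixes z :: "real ^ 'n"
  assumes "norm z = 1"
  obtains P :: "real ^ 'n \<Rightarrow> real ^ 'n" where "orthogonal_transformation P" "P (axis undefined 1) = z"
proof (rule orthogonal_transformation_exists_1)
  show "norm (axis undefined 1 :: real ^ 'n) = 1" by (simp add: norm_axis_1)
qed (use assms that in auto)

lemma weight_integrable:
  fixes z :: "real ^ 'n"
  assumes "1 < p" "norm z = 1"
  shows "integrable lborel (weight p z)"
proof -
  obtain P :: "real ^ 'n \<Rightarrow> real ^ 'n"
    where P: "orthogonal_transformation P" "P (axis undefined 1) = z"
    using ex_orthogonal_axis[OF assms(2)] .
  have [measurable]: "P \<in> borel_measurable borel" by (rule borel_measurable_orthogonal[OF P(1)])
  have "integrable (distr lborel borel P) (weight p z)"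
    using weight_axis_integrable[OF assms(1)] weight_orthogonal[OF P(1), of p "axis undefined 1"] P(2)
    by (subst integrable_distr_eq) (auto)
  then show ?thesis by (simp add: lborel_distr_orthogonal[OF P(1)])
qed


text \<open>This is \<open>norm_const p z\<close> times the volume of the unit ball, as used in
  \<open>dir_avg_eq\<close>.\<close>

definition mass :: "real \<Rightarrow> real ^ 'n \<Rightarrow> real" where
  "mass p z = (LINT h|lborel. weight p z h)"

text \<open>The law of a random step \<open>h\<close>. It turns \<open>dir_avg\<close> into an
  expectation, to which couplings apply.\<close>

definition step_measure :: "real \<Rightarrow> real ^ 'n \<Rightarrow> (real ^ 'n) measure" where
  "step_measure p z = density lborel (\<lambda>h. ennreal (weight p z h / mass p z))"

lemma sets_step_measure [measurable_cong, simp]: "sets (step_measure p z) = sets borel"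
  by (simp add: step_measure_def)

lemma space_step_measure [simp]: "space (step_measure p z) = UNIV"
  by (simp add: step_measure_def)

lemma measurable_step_measure [simp]: "measurable (step_measure p z) M = measurable borel M"
  by (rule measurable_cong_sets) simp_all

lemma measure_lborel_ball_pos: "0 < r \<Longrightarrow> 0 < measure lborel (ball (c :: real ^ 'n) r)"
  using content_ball_pos[of r c] by simp

lemma mass_orthogonal:
  fixes P :: "real ^ 'n \<Rightarrow> real ^ 'n"
  assumes "orthogonal_transformation P"
  shows "mass p (P z) = mass p z"
  using weight_integral_orthogonal[OF assms, of "\<lambda>_. 1" p z] by (simp add: mass_def)

lemma mass_eq:
  fixes z w :: "real ^ 'n"
  assumes "norm z = 1" "norm w = 1"
  shows "mass p z = mass p w"
proof -
  obtain P :: "real ^ 'n \<Rightarrow> real ^ 'n" where "orthogonal_transformation P" "P z = w"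
    using orthogonal_transformation_exists_1[OF assms] .
  then show ?thesis using mass_orthogonal[of P p z] by simp
qed

lemma integral_step_measure:
  assumes "g \<in> borel_measurable borel"
  shows "integral\<^sup>L (step_measure p z) g = (LINT h|lborel. weight p z h * g h) / mass p z"
proof -
  have "0 \<le> mass p z" by (simp add: mass_def weight_nonneg)
  then show ?thesis
    using assms by (simp add: step_measure_def integral_density weight_nonneg)
qed

lemma integral_step_measure_orthogonal:
  fixes P :: "real ^ 'n \<Rightarrow> real ^ 'n" and g :: "real ^ 'n \<Rightarrow> real"
  assumes P: "orthogonal_transformation P" and g: "g \<in> borel_measurable borel"
  shows "integral\<^sup>L (step_measure p (P z)) g = (\<integral>h. g (P h) \<partial>step_measure p z)"
proof -
  have "(\<lambda>h. g (P h)) \<in> borel_measurable borel"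
    using measurable_compose[OF borel_measurable_orthogonal[OF P] g] .
  then show ?thesis
    using g by (simp add: integral_step_measure mass_orthogonal[OF P] weight_integral_orthogonal[OF P])
qed

text \<open>Subtracting \<open>a *\<^sub>R z\<close> leaves a vector shorter than \<open>r\<close>,
  which changes the norm and the component along \<open>z\<close> by less than \<open>r\<close>.
  This places balls inside the half ball on which the kernel lives.\<close>

lemma near_direction:
  fixes z h :: "'a::euclidean_space"
  assumes z: "norm z = 1" and a: "0 \<le> a" and h: "h \<in> ball (a *\<^sub>R z) r"
  shows "norm h < a + r" "a - r < z \<bullet> h" "z \<bullet> h < a + r"
proof -
  have *: "norm (h - a *\<^sub>R z) < r" using h by (simp add: dist_norm norm_minus_commute)
  show "norm h < a + r" using norm_triangle_ineq[of "h - a *\<^sub>R z" "a *\<^sub>R z"] * z a by simp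
  have "z \<bullet> h = z \<bullet> (h - a *\<^sub>R z) + a" using z by (simp add: inner_diff_right dot_square_norm)
  moreover have "\<bar>z \<bullet> (h - a *\<^sub>R z)\<bar> < r"
    using Cauchy_Schwarz_ineq2[of z "h - a *\<^sub>R z"] * z by simp
  ultimately show "a - r < z \<bullet> h" "z \<bullet> h < a + r" by linarith+
qed

lemma integrable_indicator_ball: "integrable lborel (indicator (ball (c::'a::euclidean_space) r) :: _ \<Rightarrow> real)"
  by (intro integrable_real_indicator) (auto simp: emeasure_lborel_ball_finite[unfolded infinity_ennreal_def])

text \<open>This is where \<open>p < 2\<close> enters: the base \<open>z \<bullet> h\<close> is at
  most 1 and the exponent is negative. So on the half ball the kernel dominates Lebesgue
  measure.\<close>

lemma weight_ge_1:
  assumes "p < 2" "norm z = 1" "norm h < 1" "0 < z \<bullet> h"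
  shows "1 \<le> weight p z h"
proof -
  have "z \<bullet> h \<le> 1" using norm_cauchy_schwarz[of z h] assms by simp
  then have "(z \<bullet> h) powr 0 \<le> (z \<bullet> h) powr (p - 2)"
    using assms by (intro powr_mono') auto
  then show ?thesis using assms by (simp add: weight_def pos_pow_def)
qed

locale singular_exponent =
  fixes p :: real
  assumes p1: "1 < p" and p2: "p < 2"
begin

lemma mass_pos:
  fixes z :: "real ^ 'n"
  assumes z: "norm z = 1"
  shows "0 < mass p z"
proof -
  \<comment> \<open>The ball of radius 1/2 about \<open>(1/2) *\<^sub>R z\<close> lies in the half
    ball, where the kernel is at least 1.\<close>
  define D where "D = ball ((1/2) *\<^sub>R z) (1/2)"
  have "0 < measure lborel D" unfolding D_def by (rule measure_lborel_ball_pos) simp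
  also have "measure lborel D = (LINT h|lborel. indicator D h)" by (simp add: D_def)
  also have "\<dots> \<le> mass p z" unfolding mass_def
  proof (rule integral_mono)
    show "integrable lborel (indicator D :: _ \<Rightarrow> real)"
      unfolding D_def by (rule integrable_indicator_ball)
    show "integrable lborel (weight p z)" by (rule weight_integrable[OF p1 z])
    fix h
    show "indicator D h \<le> weight p z h"
    proof (cases "h \<in> D")
      case True
      then have "norm h < 1" "0 < z \<bullet> h"
        using near_direction[OF z, of "1/2" h "1/2"] by (auto simp: D_def)
      then show ?thesis using weight_ge_1[OF p2 z] by (simp add: True)
    qed (simp add: weight_nonneg)
  qed
  finally show ?thesis .
qed

lemma emeasure_step_measure_UNIV:
  fixes z :: "real ^ 'n"
  assumes z: "norm z = 1"
  shows "emeasure (step_measure p z) UNIV = 1"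
proof -
  have "emeasure (step_measure p z) UNIV = (\<integral>\<^sup>+h. ennreal (weight p z h / mass p z) \<partial>lborel)"
    by (simp add: step_measure_def emeasure_density)
  also have "\<dots> = ennreal (LINT h|lborel. weight p z h / mass p z)"
    using weight_integrable[OF p1 z] mass_pos[OF z]
    by (intro nn_integral_eq_integral) (auto simp: weight_nonneg)
  also have "\<dots> = 1" using mass_pos[OF z] by (simp flip: mass_def)
  finally show ?thesis .
qed

lemma finite_step_measure: "norm z = 1 \<Longrightarrow> finite_measure (step_measure p z)"
  by (rule finite_measureI) (simp add: emeasure_step_measure_UNIV)

lemma integral_step_measure_const: "norm z = 1 \<Longrightarrow> (\<integral>h. c \<partial>step_measure p z) = (c::real)"
  by (simp add: measure_def emeasure_step_measure_UNIV)

lemma step_integral_affine: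
  fixes f g :: "real ^ 'n \<Rightarrow> real"
  assumes z: "norm z = 1" and "integrable (step_measure p z) f" "integrable (step_measure p z) g"
  shows "(\<integral>h. k + a * (f h - g h) \<partial>step_measure p z)
    = k + a * (integral\<^sup>L (step_measure p z) f - integral\<^sup>L (step_measure p z) g)"
  using assms finite_measure.integrable_const[OF finite_step_measure[OF z], of k]
  by (simp add: integral_step_measure_const[OF z] del: lebesgue_integral_const)

text \<open>The density vanishes outside the open half ball, so bounds on integrands need only be
  checked there.\<close>

lemma AE_step_measure:
  assumes z: "norm z = 1"
  shows "AE h in step_measure p z. norm h < 1 \<and> 0 < z \<bullet> h"
proof -
  have "(\<lambda>h. ennreal (weight p z h / mass p z)) \<in> borel_measurable lborel" by simp
  then show ?thesis
    unfolding step_measure_def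
    by (subst AE_density) (auto simp: weight_def pos_pow_def split: split_indicator if_splits)
qed

lemma step_integrable:
  fixes g :: "real ^ 'n \<Rightarrow> real"
  assumes z: "norm z = 1" and g: "g \<in> borel_measurable borel" and b: "\<And>h. norm h < 1 \<Longrightarrow> \<bar>g h\<bar> \<le> B"
  shows "integrable (step_measure p z) g"
proof -
  interpret finite_measure "step_measure p z" by (rule finite_step_measure[OF z])
  show ?thesis
    using AE_step_measure[OF z] g b by (intro integrable_const_bound[where B = B]) auto
qed

lemma step_integral_mono:
  fixes f g :: "real ^ 'n \<Rightarrow> real"
  assumes z: "norm z = 1" and "integrable (step_measure p z) f" "integrable (step_measure p z) g"
    and le: "\<And>h. norm h < 1 \<Longrightarrow> 0 < z \<bullet> h \<Longrightarrow> f h \<le> g h"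
  shows "integral\<^sup>L (step_measure p z) f \<le> integral\<^sup>L (step_measure p z) g"
  using AE_step_measure[OF z] assms by (intro integral_mono_AE) auto

text \<open>The kernel is at least 1 on the half ball, so a nonnegative integrand keeps its Lebesgue
  integral over the smaller ball, up to \<open>mass\<close>. The constants \<open>pull\<close> and
  \<open>overlap\<close> both rest on this.\<close>

lemma step_integral_ge:
  fixes z :: "real ^ 'n"
  assumes z: "norm z = 1" and g: "g \<in> borel_measurable borel" and B: "\<And>h. \<bar>g h\<bar> \<le> B"
    and nonneg: "\<And>h. norm h < 1 \<Longrightarrow> 0 \<le> g h"
    and sub: "\<And>h. h \<in> ball c r \<Longrightarrow> norm h < 1 \<and> 0 < z \<bullet> h"
  shows "(LINT h|lborel. indicator (ball c r) h * g h) / mass p z \<le> integral\<^sup>L (step_measure p z) g"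
proof -
  have "(LINT h|lborel. indicator (ball c r) h * g h) \<le> (LINT h|lborel. weight p z h * g h)"
  proof (rule integral_mono)
    have B': "\<bar>g h\<bar> \<le> \<bar>B\<bar>" for h using B[of h] by linarith
    show "integrable lborel (\<lambda>h. weight p z h * g h)"
    proof (rule Bochner_Integration.integrable_bound)
      show "integrable lborel (\<lambda>h. weight p z h * \<bar>B\<bar>)" by (intro integrable_mult_left weight_integrable[OF p1 z])
    qed (use g B' in \<open>auto simp: abs_mult weight_nonneg intro!: AE_I2 mult_left_mono\<close>)
    show "integrable lborel (\<lambda>h. indicator (ball c r) h * g h)"
    proof (rule Bochner_Integration.integrable_bound)
      show "integrable lborel (\<lambda>h. indicator (ball c r) h * \<bar>B\<bar>)" by (intro integrable_mult_left integrable_indicator_ball)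
    qed (use g B' in \<open>auto simp: abs_mult intro!: AE_I2 mult_left_mono borel_measurable_times borel_measurable_indicator\<close>)
    fix h
    consider "h \<in> ball c r" | "h \<notin> ball c r" "norm h < 1" | "h \<notin> ball c r" "1 \<le> norm h" by force
    then show "indicator (ball c r) h * g h \<le> weight p z h * g h"
    proof cases
      case 1
      then show ?thesis
        using mult_right_mono[OF weight_ge_1[OF p2 z, of h] nonneg] sub[OF 1] by simp
    qed (simp_all add: weight_nonneg nonneg, simp add: weight_def)
  qed
  then show ?thesis
    using mass_pos[OF z] by (simp add: integral_step_measure[OF g] divide_right_mono)
qed

lemma measure_step_measure_ge:
  fixes z :: "real ^ 'n"
  assumes z: "norm z = 1" and A: "A \<in> sets borel" and D: "ball c r \<subseteq> A"
    and sub: "\<And>h. h \<in> ball c r \<Longrightarrow> norm h < 1 \<and> 0 < z \<bullet> h"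
  shows "measure lborel (ball c r) / mass p z \<le> measure (step_measure p z) A"
proof -
  have "(\<lambda>h. indicator (ball c r) h * indicator A h :: real) = indicator (ball c r)"
    using D by (auto simp: fun_eq_iff split: split_indicator)
  moreover have "(LINT h|lborel. indicator (ball c r) h * indicator A h) / mass p z \<le> integral\<^sup>L (step_measure p z) (indicator A)"
    by (rule step_integral_ge[OF z, where B = 1]) (use A sub in auto)
  ultimately show ?thesis using A by simp
qed

text \<open>Guaranteed common mass of two steps with the same unit vector from points at most
  \<open>\<epsilon>/2\<close> apart along it: a ball of radius 1/4 fits into both half balls. The
  argument only fixes the dimension; by rotation invariance the axis vector stands for any unit
  vector.\<close>

definition overlap :: "'n::finite itself \<Rightarrow> real" where
  "overlap _ = measure lborel (ball (0 :: real ^ 'n) (1/4)) / mass p (axis undefined 1 :: real ^ 'n)"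

lemma overlap_pos: "0 < overlap TYPE('n::finite)"
  unfolding overlap_def by (intro divide_pos_pos measure_lborel_ball_pos mass_pos) auto

text \<open>A lower bound for the probability that a step advances by between 1/8 and 1/4 along its
  own direction; a ball of radius 1/16 fits into that slab.\<close>

definition pull :: "'n::finite itself \<Rightarrow> real" where
  "pull _ = measure lborel (ball (0 :: real ^ 'n) (1/16)) / mass p (axis undefined 1 :: real ^ 'n)"

text \<open>The length of the mean step: by \<open>step_integral_inner\<close> the mean of
  \<open>h\<close> is this multiple of \<open>z\<close>.\<close>

definition drift :: "'n::finite itself \<Rightarrow> real" where
  "drift _ = (\<integral>h. axis undefined 1 \<bullet> h \<partial>step_measure p (axis undefined 1 :: real ^ 'n))"

lemma pull_pos: "0 < pull TYPE('n::finite)"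
  unfolding pull_def
  by (intro divide_pos_pos measure_lborel_ball_pos mass_pos) auto

lemma measure_ball_translate:
  "measure lborel (ball (c :: real ^ 'n) r) = measure lborel (ball (0 :: real ^ 'n) r)"
  by (cases "0 \<le> r") (simp_all add: content_ball ball_empty)

lemma pull_le:
  fixes z :: "real ^ 'n"
  assumes z: "norm z = 1"
  shows "pull TYPE('n) \<le> measure (step_measure p z) {h. 1/8 < z \<bullet> h \<and> z \<bullet> h < 1/4}"
proof -
  have b: "norm h < 1 \<and> 1/8 < z \<bullet> h \<and> z \<bullet> h < 1/4" if "h \<in> ball ((3/16) *\<^sub>R z) (1/16)" for h
    using near_direction[OF z, of "3/16" h "1/16"] that by auto
  have "pull TYPE('n) = measure lborel (ball ((3/16) *\<^sub>R z) (1/16)) / mass p z"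
    unfolding pull_def using mass_eq[of "axis undefined 1" z p] z
    by (simp add: measure_ball_translate[of "(3/16) *\<^sub>R z"])
  also have "\<dots> \<le> measure (step_measure p z) {h. 1/8 < z \<bullet> h \<and> z \<bullet> h < 1/4}"
    by (rule measure_step_measure_ge[OF z]) (use b in force)+
  finally show ?thesis .
qed

lemma drift_eq:
  fixes z :: "real ^ 'n"
  assumes z: "norm z = 1"
  shows "(\<integral>h. z \<bullet> h \<partial>step_measure p z) = drift TYPE('n)"
proof -
  obtain P :: "real ^ 'n \<Rightarrow> real ^ 'n"
    where P: "orthogonal_transformation P" "P (axis undefined 1) = z"
    using ex_orthogonal_axis[OF z] .
  have "(\<integral>h. z \<bullet> h \<partial>step_measure p z) = (\<integral>h. z \<bullet> P h \<partial>step_measure p (axis undefined 1 :: real ^ 'n))"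
    unfolding P(2)[symmetric] by (subst integral_step_measure_orthogonal[OF P(1)]) auto
  also have "(\<lambda>h. z \<bullet> P h) = (\<lambda>h. axis undefined 1 \<bullet> h)"
    using P(1) by (simp add: orthogonal_transformation_def flip: P(2))
  finally show ?thesis by (simp add: drift_def)
qed

lemma inner_integrable:
  fixes z k :: "real ^ 'n"
  shows "norm z = 1 \<Longrightarrow> integrable (step_measure p z) (\<lambda>h. k \<bullet> h)"
proof (rule step_integrable[where B = "norm k"])
  fix h :: "real ^ 'n" assume "norm h < 1"
  then show "\<bar>k \<bullet> h\<bar> \<le> norm k"
    using Cauchy_Schwarz_ineq2[of k h] mult_left_mono[of "norm h" 1 "norm k"] by simp
qed auto

text \<open>The component of the step along \<open>z\<close> is positive almost everywhere, and it
  exceeds 1/8 with probability at least \<open>pull\<close>.\<close>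

lemma drift_bounds: "0 < drift TYPE('n::finite)" "drift TYPE('n) \<le> 1"
proof -
  define z :: "real ^ 'n" where "z = axis undefined 1"
  have z: "norm z = 1" by (simp add: z_def norm_axis_1)
  let ?A = "{h. 1/8 < z \<bullet> h \<and> z \<bullet> h < 1/4}"
  interpret finite_measure "step_measure p z" by (rule finite_step_measure[OF z])
  have "0 < pull TYPE('n) * (1/8)" using pull_pos by simp
  also have "\<dots> \<le> measure (step_measure p z) ?A * (1/8)"
    using pull_le[OF z] by simp
  also have "\<dots> = (\<integral>h. indicator ?A h * (1/8) \<partial>step_measure p z)" by simp
  also have "\<dots> \<le> (\<integral>h. z \<bullet> h \<partial>step_measure p z)"
    by (rule step_integral_mono[OF z step_integrable[where B = 1] inner_integrable[OF z]])
      (auto simp: z split: split_indicator)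
  finally show "0 < drift TYPE('n)" by (simp add: drift_eq[OF z])
  have "(\<integral>h. z \<bullet> h \<partial>step_measure p z) \<le> (\<integral>h. 1 \<partial>step_measure p z)"
    by (rule step_integral_mono[OF z inner_integrable[OF z]])
      (use z in \<open>auto intro: order_trans[OF norm_cauchy_schwarz]\<close>)
  then show "drift TYPE('n) \<le> 1" by (simp only: drift_eq[OF z] integral_step_measure_const[OF z])
qed

end

subsection \<open>Expansion of the square root of the distance under reflection\<close>

definition reflection :: "'a::euclidean_space \<Rightarrow> 'a \<Rightarrow> 'a" where
  "reflection n h = h - (2 * (n \<bullet> h)) *\<^sub>R n"

lemma orthogonal_transformation_reflection:
  assumes "norm n = 1"
  shows "orthogonal_transformation (reflection n)"
  unfolding orthogonal_transformation_def
proof (intro conjI allI)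
  show "linear (reflection n)"
    by (rule linearI) (simp_all add: reflection_def inner_add_right algebra_simps)
  fix v w show "reflection n v \<bullet> reflection n w = v \<bullet> w"
    using assms by (simp add: reflection_def inner_diff_left inner_diff_right dot_square_norm inner_commute)
qed

text \<open>For unit vectors \<open>(z - w) \<bullet> z\<close> is half the square of
  \<open>norm (z - w)\<close>, so the reflection subtracts exactly \<open>z - w\<close> from
  \<open>z\<close>.\<close>

lemma reflection_swap:
  assumes "norm z = 1" "norm w = 1" "z \<noteq> w"
  shows "reflection ((1 / norm (z - w)) *\<^sub>R (z - w)) z = w"
proof -
  have "z \<bullet> z = 1" "w \<bullet> w = 1" using assms by (simp_all add: norm_eq_1)
  then have "norm (z - w) ^ 2 = 2 * ((z - w) \<bullet> z)"
    unfolding power2_norm_eq_inner by (simp add: inner_diff_left inner_diff_right inner_commute)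
  moreover have "(norm (z - w))\<^sup>2 \<noteq> 0" using assms(3) by simp
  ultimately have *: "2 * ((z - w) \<bullet> z) / (norm (z - w))\<^sup>2 = 1" by (metis divide_self)
  have "reflection ((1 / norm (z - w)) *\<^sub>R (z - w)) z = z - (2 * ((z - w) \<bullet> z) / (norm (z - w))\<^sup>2) *\<^sub>R (z - w)"
    unfolding reflection_def inner_scaleR_left scaleR_scaleR by (simp add: power2_eq_square)
  then show ?thesis unfolding * by simp
qed

text \<open>An upper bound for the fourth root of \<open>1 + q\<close>. The Taylor coefficient of
  \<open>q\<^sup>2\<close> is -3/32; the weaker -1/12 leaves room for the remainder on this
  range.\<close>

lemma one_plus_le_fourth_power:
  fixes q :: real
  assumes q: "\<bar>q\<bar> \<le> 1/12"
  shows "1 + q \<le> (1 + q/4 - q\<^sup>2/12) ^ 4"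
proof -
  define b where "b = 1 - q/3"
  define a where "a = q/4 - q\<^sup>2/12"
  have ab: "a = (q/4) * b" by (simp add: a_def b_def power2_eq_square algebra_simps)
  have b: "35/36 \<le> b" "b \<le> 37/36" using q by (auto simp: b_def)
  have "\<bar>a\<bar> \<le> 1/48 * (37/36)"
    unfolding ab abs_mult using q b by (intro mult_mono) auto
  then have a: "29/5 \<le> 6 + 4 * a" by linarith
  have "(35/36)\<^sup>2 \<le> b\<^sup>2" using b by (intro power_mono) auto
  then have "(q/4)\<^sup>2 * (35/36)\<^sup>2 \<le> a\<^sup>2"
    unfolding ab power_mult_distrib by (rule mult_left_mono) simp
  then have "((q/4)\<^sup>2 * (35/36)\<^sup>2) * (29/5) \<le> a\<^sup>2 * (6 + 4 * a)"
    using a by (intro mult_mono) auto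
  moreover have "q\<^sup>2/3 \<le> ((q/4)\<^sup>2 * (35/36)\<^sup>2) * (29/5)"
    by (simp add: power2_eq_square)
  moreover have "(1 + a) ^ 4 = 1 + 4 * a + a\<^sup>2 * (6 + 4 * a) + (a\<^sup>2)\<^sup>2"
    by (simp add: power2_eq_square power4_eq_xxxx algebra_simps)
  moreover have "0 \<le> (a\<^sup>2)\<^sup>2" by simp
  moreover have "4 * a = q - q\<^sup>2/3" by (simp add: a_def)
  ultimately have "1 + q \<le> (1 + a) ^ 4" by linarith
  then show ?thesis by (simp add: a_def algebra_simps)
qed

text \<open>The squared norm is \<open>t\<^sup>2 * (1 + q)\<close>, so the left side is
  \<open>sqrt t\<close> times the fourth root of \<open>1 + q\<close>. The first bound keeps the
  negative second-order term along \<open>e\<close>, which expresses the concavity of the square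
  root; the second serves where the first-order term decides.\<close>

lemma sqrt_norm_expansion:
  fixes e v :: "'a::euclidean_space"
  assumes e: "norm e = 1" and v: "norm v \<le> 2" and t: "0 < t" and \<epsilon>: "0 < \<epsilon>" "\<epsilon> \<le> t / 64"
  shows "sqrt (norm (t *\<^sub>R e + \<epsilon> *\<^sub>R v)) \<le>
    sqrt t * (1 + (\<epsilon>/t) * (v \<bullet> e) / 2 + (\<epsilon>/t)\<^sup>2 * ((norm v)\<^sup>2 / 4 - (v \<bullet> e)\<^sup>2 / 3) + 3 * (\<epsilon>/t) ^ 3)" (is "?l \<le> _")
    and "sqrt (norm (t *\<^sub>R e + \<epsilon> *\<^sub>R v)) \<le> sqrt t * (1 + (\<epsilon>/t) * (v \<bullet> e) / 2 + (\<epsilon>/t)\<^sup>2)"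
proof -
  define d where "d = \<epsilon> / t"
  define s where "s = v \<bullet> e"
  define m where "m = (norm v)\<^sup>2"
  define q where "q = 2 * d * s + d\<^sup>2 * m"
  have d: "0 < d" "d \<le> 1/64" using t \<epsilon> by (auto simp: d_def field_simps)
  have s: "\<bar>s\<bar> \<le> 2" using Cauchy_Schwarz_ineq2[of v e] e v by (simp add: s_def)
  have m: "0 \<le> m" "m \<le> 4" using power_mono[OF v, of 2] by (auto simp: m_def)
  have d2: "d\<^sup>2 \<le> d / 64" using d mult_left_mono[of d "1/64" d] by (simp add: power2_eq_square)
  have d2m: "0 \<le> d\<^sup>2 * m" "d\<^sup>2 * m \<le> 4 * d\<^sup>2" using m mult_left_mono[OF m(2), of "d\<^sup>2"] by auto
  have ds: "\<bar>d * s\<bar> \<le> 2 * d" using s d mult_left_mono[OF s, of d] by (simp add: abs_mult)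
  have q: "\<bar>q\<bar> \<le> 1/12" unfolding q_def mult.assoc using ds d2m d2 d unfolding abs_le_iff by linarith
  have "(norm (t *\<^sub>R e + \<epsilon> *\<^sub>R v))\<^sup>2 = t\<^sup>2 + 2 * t * \<epsilon> * s + \<epsilon>\<^sup>2 * m"
    using e unfolding m_def s_def power2_norm_eq_inner norm_eq_1
    by (simp add: inner_add_left inner_add_right inner_commute power2_eq_square algebra_simps)
  also have "\<dots> = t\<^sup>2 * (1 + q)" using t by (simp add: q_def d_def power2_eq_square field_simps)
  finally have n2: "(norm (t *\<^sub>R e + \<epsilon> *\<^sub>R v))\<^sup>2 = t\<^sup>2 * (1 + q)" .
  have q2: "q\<^sup>2 \<le> \<bar>q\<bar>/12" using mult_left_mono[OF q, of "\<bar>q\<bar>"] by (simp add: power2_eq_square abs_mult_self_eq)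
  \<comment> \<open>Fourth powers are compared; the rule speaks of \<open>Suc n\<close>, hence
    \<open>n = 3\<close>.\<close>
  have "?l \<le> sqrt t * (1 + q/4 - q\<^sup>2/12)"
  proof (rule power_le_imp_le_base[where n = 3])
    show "0 \<le> sqrt t * (1 + q/4 - q\<^sup>2/12)" using t q q2 by (intro mult_nonneg_nonneg) auto
    have "?l ^ 4 = (norm (t *\<^sub>R e + \<epsilon> *\<^sub>R v))\<^sup>2" using power_mult[of ?l 2 2] by simp
    also have "\<dots> \<le> t\<^sup>2 * (1 + q/4 - q\<^sup>2/12) ^ 4" unfolding n2
      using one_plus_le_fourth_power[OF q] by (intro mult_left_mono) auto
    also have "\<dots> = (sqrt t * (1 + q/4 - q\<^sup>2/12)) ^ 4"
      using power_mult[of "sqrt t" 2 2] t by (simp add: power_mult_distrib)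
    finally show "?l ^ Suc 3 \<le> (sqrt t * (1 + q/4 - q\<^sup>2/12)) ^ Suc 3" by simp
  qed
  note main = this
  have "q\<^sup>2 = 4 * d\<^sup>2 * s\<^sup>2 + 4 * d^3 * (s * m) + (d\<^sup>2 * m)\<^sup>2"
    by (simp add: q_def power2_eq_square power3_eq_cube algebra_simps)
  moreover have "\<bar>s * m\<bar> \<le> 8" using mult_mono[OF s m(2)] m by (simp add: abs_mult)
  then have "d^3 * (- (s * m)) \<le> d^3 * 8" using d by (intro mult_left_mono) auto
  moreover have "0 \<le> (d\<^sup>2 * m)\<^sup>2" by simp
  moreover have "0 \<le> d^3" using d by simp
  ultimately have "- (q\<^sup>2/12) \<le> - (d\<^sup>2 * s\<^sup>2 / 3) + 3 * d^3" by linarith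
  then have "1 + q/4 - q\<^sup>2/12 \<le> 1 + d * s / 2 + d\<^sup>2 * (m/4 - s\<^sup>2/3) + 3 * d^3"
    using q_def right_diff_distrib[of "d\<^sup>2" "m/4" "s\<^sup>2/3"] by linarith
  then show "?l \<le> sqrt t * (1 + (\<epsilon>/t) * (v \<bullet> e) / 2 + (\<epsilon>/t)\<^sup>2 * ((norm v)\<^sup>2 / 4 - (v \<bullet> e)\<^sup>2 / 3) + 3 * (\<epsilon>/t) ^ 3)"
    using main t unfolding d_def s_def m_def by (meson mult_left_mono order_trans less_imp_le real_sqrt_ge_0_iff)
  have "1 + q/4 - q\<^sup>2/12 \<le> 1 + d * s / 2 + d\<^sup>2"
    using d2m zero_le_power2[of q] q_def by linarith
  then show "?l \<le> sqrt t * (1 + (\<epsilon>/t) * (v \<bullet> e) / 2 + (\<epsilon>/t)\<^sup>2)"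
    using main t unfolding d_def s_def by (meson mult_left_mono order_trans less_imp_le real_sqrt_ge_0_iff)
qed

text \<open>The operator of \<open>dir_avg\<close> written as an expectation;
  \<open>dir_avg_eq\<close> relates the two.\<close>

definition avg :: "real \<Rightarrow> real \<Rightarrow> real ^ 'n \<Rightarrow> (real ^ 'n \<Rightarrow> real) \<Rightarrow> real ^ 'n \<Rightarrow> real" where
  "avg p \<epsilon> z u x = (\<integral>h. u (x + \<epsilon> *\<^sub>R h) \<partial>step_measure p z)"

section \<open>First and second moments of a step\<close>

context singular_exponent
begin

text \<open>The map \<open>R\<close> fixes \<open>z\<close> and negates its orthogonal complement,
  so the law of the step is symmetric about the axis \<open>z\<close> and its mean is a multiple of
  \<open>z\<close>.\<close>

lemma step_integral_inner:
  fixes z k :: "real ^ 'n"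
  assumes z: "norm z = 1"
  shows "(\<integral>h. k \<bullet> h \<partial>step_measure p z) = drift TYPE('n) * (k \<bullet> z)"
proof -
  define R where "R h = - reflection z h" for h
  have R: "orthogonal_transformation R"
    using orthogonal_transformation_reflection[OF z] unfolding R_def orthogonal_transformation_neg .
  have Rz: "R z = z" using z by (simp add: R_def reflection_def dot_square_norm scaleR_2)
  have "(\<integral>h. k \<bullet> h \<partial>step_measure p z) = (\<integral>h. k \<bullet> R h \<partial>step_measure p z)"
    using integral_step_measure_orthogonal[OF R, of "\<lambda>h. k \<bullet> h" p z] by (simp add: Rz)
  also have "(\<lambda>h. k \<bullet> R h) = (\<lambda>h. (2 * (k \<bullet> z)) * (z \<bullet> h) - k \<bullet> h)"
    by (simp add: R_def reflection_def inner_diff_right fun_eq_iff)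
  also have "(\<integral>h. (2 * (k \<bullet> z)) * (z \<bullet> h) - k \<bullet> h \<partial>step_measure p z)
      = (2 * (k \<bullet> z)) * drift TYPE('n) - (\<integral>h. k \<bullet> h \<partial>step_measure p z)"
    using inner_integrable[OF z] by (simp add: drift_eq[OF z])
  finally show ?thesis by simp
qed

lemma inner_power2_integrable:
  fixes z k :: "real ^ 'n"
  assumes z: "norm z = 1"
  shows "integrable (step_measure p z) (\<lambda>h. (k \<bullet> h)\<^sup>2)"
proof (rule step_integrable[OF z, where B = "(norm k)\<^sup>2"])
  fix h :: "real ^ 'n" assume "norm h < 1"
  then have "\<bar>k \<bullet> h\<bar> \<le> norm k"
    using Cauchy_Schwarz_ineq2[of k h] mult_left_mono[of "norm h" 1 "norm k"] by simp
  then show "\<bar>(k \<bullet> h)\<^sup>2\<bar> \<le> (norm k)\<^sup>2" using power_mono[of "\<bar>k \<bullet> h\<bar>" "norm k" 2] by simp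
qed auto

text \<open>The variance is nonnegative, so the second moment is at least the square of the
  mean.\<close>

lemma step_integral_inner_power2:
  fixes z k :: "real ^ 'n"
  assumes z: "norm z = 1"
  shows "(drift TYPE('n) * (k \<bullet> z))\<^sup>2 \<le> (\<integral>h. (k \<bullet> h)\<^sup>2 \<partial>step_measure p z)"
proof -
  define m where "m = drift TYPE('n) * (k \<bullet> z)"
  have "0 \<le> (\<integral>h. (k \<bullet> h - m)\<^sup>2 \<partial>step_measure p z)" by simp
  also have "(\<lambda>h. (k \<bullet> h - m)\<^sup>2) = (\<lambda>h. (k \<bullet> h)\<^sup>2 - (2 * m) * (k \<bullet> h) + m\<^sup>2)"
    by (simp add: power2_eq_square algebra_simps fun_eq_iff)
  also have "(\<integral>h. (k \<bullet> h)\<^sup>2 - (2 * m) * (k \<bullet> h) + m\<^sup>2 \<partial>step_measure p z)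
      = (\<integral>h. (k \<bullet> h)\<^sup>2 \<partial>step_measure p z) - (2 * m) * m + m\<^sup>2"
    using inner_integrable[OF z] inner_power2_integrable[OF z]
      finite_measure.integrable_const[OF finite_step_measure[OF z], of "m\<^sup>2"]
    by (simp add: step_integral_inner[OF z] m_def integral_step_measure_const[OF z] del: lebesgue_integral_const)
  finally show ?thesis unfolding m_def[symmetric] using power2_eq_square[of m] by linarith
qed

end

subsection \<open>Couplings of two steps\<close>

lemma reflection_displacement:
  assumes "norm n = 1"
  shows "h - reflection n h = (2 * (n \<bullet> h)) *\<^sub>R n"
  by (simp add: reflection_def)

lemma norm_add_scaleR_power2_le:
  fixes a h :: "'a::euclidean_space"
  assumes "norm a \<le> 1" "norm h \<le> 1" "0 < \<epsilon>" "\<epsilon> \<le> 1"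
  shows "(norm (a + \<epsilon> *\<^sub>R h))\<^sup>2 \<le> (norm a)\<^sup>2 + 3 * \<epsilon>"
proof -
  have "norm (a + \<epsilon> *\<^sub>R h) \<le> norm a + \<epsilon>"
    using norm_triangle_ineq[of a "\<epsilon> *\<^sub>R h"] mult_left_le[OF assms(2), of \<epsilon>] assms(3)
    by (simp only: norm_scaleR) linarith
  then have "(norm (a + \<epsilon> *\<^sub>R h))\<^sup>2 \<le> (norm a + \<epsilon>)\<^sup>2" by (rule power_mono) simp
  also have "\<dots> = (norm a)\<^sup>2 + 2 * (norm a * \<epsilon>) + \<epsilon> * \<epsilon>" by (simp add: power2_eq_square algebra_simps)
  also have "norm a * \<epsilon> \<le> 1 * \<epsilon>" using assms by (intro mult_right_mono) auto
  also have "\<epsilon> * \<epsilon> \<le> 1 * \<epsilon>" using assms by (intro mult_right_mono) auto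
  finally show ?thesis by simp
qed

context singular_exponent
begin

context
  fixes u :: "real ^ 'n \<Rightarrow> real"
  assumes u_meas [measurable]: "u \<in> borel_measurable borel" and u_bound: "\<And>x. \<bar>u x\<bar> \<le> 1"
begin

lemma shift_integrable:
  fixes z :: "real ^ 'n" and P :: "real ^ 'n \<Rightarrow> real ^ 'n"
  assumes z: "norm z = 1" and P: "P \<in> borel_measurable borel"
  shows "integrable (step_measure p z) (\<lambda>h. u (x + \<epsilon> *\<^sub>R P h))"
proof (rule step_integrable[OF z _ u_bound])
  show "(\<lambda>h. u (x + \<epsilon> *\<^sub>R P h)) \<in> borel_measurable borel" using P by measurable
qed

lemma avg_orthogonal:
  fixes P :: "real ^ 'n \<Rightarrow> real ^ 'n"
  assumes P: "orthogonal_transformation P" "P z = w"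
  shows "avg p \<epsilon> w u x = (\<integral>h. u (x + \<epsilon> *\<^sub>R P h) \<partial>step_measure p z)"
  unfolding avg_def P(2)[symmetric] by (subst integral_step_measure_orthogonal[OF P(1)]) auto

text \<open>Coupling: the same \<open>h\<close> drives both steps, as \<open>P h\<close> at
  \<open>y\<close>, because \<open>P\<close> carries the law for \<open>z\<close> to the law for
  \<open>w\<close>. A pointwise bound on the coupled difference is then integrated.\<close>

lemma avg_diff_le:
  fixes z :: "real ^ 'n"
  assumes z: "norm z = 1" and P: "orthogonal_transformation P" "P z = w"
    and Q: "integrable (step_measure p z) Q"
    and le: "\<And>h. norm h < 1 \<Longrightarrow> u (x + \<epsilon> *\<^sub>R h) - u (y + \<epsilon> *\<^sub>R P h) \<le> Q h"
  shows "avg p \<epsilon> z u x - avg p \<epsilon> w u y \<le> integral\<^sup>L (step_measure p z) Q"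
proof -
  note i = shift_integrable[OF z, of "\<lambda>h. h" x \<epsilon>] shift_integrable[OF z borel_measurable_orthogonal[OF P(1)], of y \<epsilon>]
  have "avg p \<epsilon> z u x - avg p \<epsilon> w u y
    = (\<integral>h. u (x + \<epsilon> *\<^sub>R h) - u (y + \<epsilon> *\<^sub>R P h) \<partial>step_measure p z)"
    unfolding avg_orthogonal[OF P] using i by (simp add: avg_def)
  also have "\<dots> \<le> integral\<^sup>L (step_measure p z) Q"
    by (rule step_integral_mono[OF z _ Q]) (use i le in auto)
  finally show ?thesis .
qed

lemma avg_diff_le_const:
  fixes z w :: "real ^ 'n"
  assumes z: "norm z = 1" "norm w = 1" and \<epsilon>: "0 < \<epsilon>"
    and le: "\<And>a b. norm (a - x) \<le> \<epsilon> \<Longrightarrow> norm (b - y) \<le> \<epsilon> \<Longrightarrow> u a - u b \<le> W"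
  shows "avg p \<epsilon> z u x - avg p \<epsilon> w u y \<le> W"
proof -
  obtain P :: "real ^ 'n \<Rightarrow> real ^ 'n" where P: "orthogonal_transformation P" "P z = w"
    using orthogonal_transformation_exists_1[OF z] .
  have "avg p \<epsilon> z u x - avg p \<epsilon> w u y \<le> (\<integral>h. W \<partial>step_measure p z)"
  proof (rule avg_diff_le[OF z(1) P])
    show "integrable (step_measure p z) (\<lambda>h. W)"
      by (rule finite_measure.integrable_const[OF finite_step_measure[OF z(1)]])
  qed (use \<epsilon> in \<open>auto intro!: le simp: orthogonal_transformation_norm[OF P(1)]\<close>)
  then show ?thesis by (simp only: integral_step_measure_const[OF z(1)])
qed

text \<open>Under the mirror coupling \<open>h - reflection e h\<close> is a multiple of
  \<open>e\<close>, so \<open>x\<close> and \<open>y\<close> stay on one line up to a common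
  displacement. On the event behind \<open>pull\<close> the distance shrinks by between
  \<open>\<epsilon>/4\<close> and \<open>\<epsilon>/2\<close>, and
  \<open>\<epsilon>/2 \<le> t\<close> excludes overshooting. Elsewhere the bound \<open>W\<close> is
  used.\<close>

lemma avg_diff_le_pull:
  fixes e :: "real ^ 'n"
  assumes e: "norm e = 1" and \<epsilon>: "0 < \<epsilon>"
    and W: "\<And>a b. norm (a - x) \<le> \<epsilon> \<Longrightarrow> norm (b - y) \<le> \<epsilon> \<Longrightarrow> u a - u b \<le> W"
    and xy: "x - y = t *\<^sub>R e" and t: "\<epsilon>/2 \<le> t" and r: "0 \<le> r"
    and V: "\<And>a b. norm (a - x) \<le> \<epsilon> \<Longrightarrow> norm (b - y) \<le> \<epsilon> \<Longrightarrow> norm (a - b) \<le> t - \<epsilon>/4 \<Longrightarrow> u a - u b \<le> W - r"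
  shows "avg p \<epsilon> (- e) u x - avg p \<epsilon> e u y \<le> W - pull TYPE('n) * r"
proof -
  have z: "norm (- e) = 1" using e by simp
  have P: "orthogonal_transformation (reflection e)" "reflection e (- e) = e"
    using e by (auto simp: orthogonal_transformation_reflection reflection_def dot_square_norm scaleR_2)
  define A where "A = {h. 1/8 < (- e) \<bullet> h \<and> (- e) \<bullet> h < 1/4}"
  have [measurable]: "A \<in> sets borel" unfolding A_def by measurable
  interpret finite_measure "step_measure p (- e)" by (rule finite_step_measure[OF z])
  have iA: "integrable (step_measure p (- e)) (\<lambda>h. indicator A h * r)"
    by (rule step_integrable[OF z, where B = "\<bar>r\<bar>"]) (auto split: split_indicator)
  have "avg p \<epsilon> (- e) u x - avg p \<epsilon> e u y \<le> (\<integral>h. W - indicator A h * r \<partial>step_measure p (- e))"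
  proof (rule avg_diff_le[OF z P])
    fix h :: "real ^ 'n" assume h: "norm h < 1"
    let ?a = "x + \<epsilon> *\<^sub>R h" and ?b = "y + \<epsilon> *\<^sub>R reflection e h"
    have ab: "norm (?a - x) \<le> \<epsilon>" "norm (?b - y) \<le> \<epsilon>"
      using h \<epsilon> by (auto simp: orthogonal_transformation_norm[OF P(1)])
    show "u ?a - u ?b \<le> W - indicator A h * r"
    proof (cases "h \<in> A")
      case True
      have "?a - ?b = (x - y) + \<epsilon> *\<^sub>R (h - reflection e h)" by (simp add: algebra_simps)
      also have "\<dots> = (t + 2 * \<epsilon> * (e \<bullet> h)) *\<^sub>R e"
        unfolding xy reflection_displacement[OF e] by (simp add: algebra_simps)
      finally have "norm (?a - ?b) = \<bar>t + 2 * \<epsilon> * (e \<bullet> h)\<bar>" using e by simp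
      moreover have "1/8 \<le> - (e \<bullet> h)" "- (e \<bullet> h) \<le> 1/4" using True by (auto simp: A_def)
      then have "\<epsilon> * (1/8) \<le> \<epsilon> * - (e \<bullet> h)" "\<epsilon> * - (e \<bullet> h) \<le> \<epsilon> * (1/4)"
        using \<epsilon> by (auto simp only: intro!: mult_left_mono)
      ultimately have "norm (?a - ?b) \<le> t - \<epsilon>/4" using t by (simp add: abs_le_iff)
      then show ?thesis using V[OF ab] True by simp
    next
      case False
      then show ?thesis using W[OF ab] by simp
    qed
  qed (use iA in auto)
  also have "\<dots> = W - measure (step_measure p (- e)) A * r"
    using iA by (simp add: integral_step_measure_const[OF z] del: lebesgue_integral_const)
  also have "\<dots> \<le> W - pull TYPE('n) * r"
    using mult_right_mono[OF pull_le[OF z] r] by (simp add: A_def)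
  finally show ?thesis .
qed

text \<open>The first-order term sees only the two means, which point along \<open>z\<close> and
  \<open>w\<close>, so any orthogonal \<open>P\<close> with \<open>P z = w\<close> will do.
  Second-order terms are estimated crudely, and the quadratic penalty costs order
  \<open>\<epsilon>\<close>.\<close>

lemma avg_diff_le_drift:
  fixes e z w :: "real ^ 'n"
  assumes e: "norm e = 1" and z: "norm z = 1" "norm w = 1"
    and xy: "x - y = t *\<^sub>R e" and t: "0 < t" and \<epsilon>: "0 < \<epsilon>" "\<epsilon> \<le> t / 64" "\<epsilon> \<le> 1"
    and x: "norm (x - x\<^sub>0) \<le> 1" and C: "0 \<le> C" and M: "0 \<le> M"
    and H: "\<And>a b. u a - u b \<le> \<theta> + C * sqrt (norm (a - b)) + M * (norm (a - x\<^sub>0))\<^sup>2"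
  shows "avg p \<epsilon> z u x - avg p \<epsilon> w u y \<le> \<theta>
    + C * (sqrt t * (1 + (\<epsilon>/t) * (drift TYPE('n) * ((z - w) \<bullet> e)) / 2 + (\<epsilon>/t)\<^sup>2))
    + M * ((norm (x - x\<^sub>0))\<^sup>2 + 3 * \<epsilon>)"
proof -
  obtain P :: "real ^ 'n \<Rightarrow> real ^ 'n" where P: "orthogonal_transformation P" "P z = w"
    using orthogonal_transformation_exists_1[OF z] .
  let ?Q = "\<lambda>h. (\<theta> + C * sqrt t * (1 + (\<epsilon>/t)\<^sup>2) + M * ((norm (x - x\<^sub>0))\<^sup>2 + 3 * \<epsilon>))
    + (C * sqrt t * (\<epsilon>/t) / 2) * (e \<bullet> h - e \<bullet> P h)"
  have [measurable]: "P \<in> borel_measurable borel" by (rule borel_measurable_orthogonal[OF P(1)])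
  have iP: "integrable (step_measure p z) (\<lambda>h. e \<bullet> P h)"
  proof (rule step_integrable[OF z(1), where B = 1])
    fix h :: "real ^ 'n" assume "norm h < 1"
    then show "\<bar>e \<bullet> P h\<bar> \<le> 1"
      using Cauchy_Schwarz_ineq2[of e "P h"] e by (simp add: orthogonal_transformation_norm[OF P(1)])
  qed measurable
  note i = iP inner_integrable[OF z(1), of e] finite_measure.integrable_const[OF finite_step_measure[OF z(1)]]
  have "avg p \<epsilon> z u x - avg p \<epsilon> w u y \<le> integral\<^sup>L (step_measure p z) ?Q"
  proof (rule avg_diff_le[OF z(1) P])
    show "integrable (step_measure p z) ?Q"
      by (intro Bochner_Integration.integrable_add Bochner_Integration.integrable_diff integrable_mult_right i)
    fix h :: "real ^ 'n" assume h: "norm h < 1"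
    let ?a = "x + \<epsilon> *\<^sub>R h" and ?b = "y + \<epsilon> *\<^sub>R P h"
    have v: "norm (h - P h) \<le> 2"
      using norm_triangle_ineq4[of h "P h"] h by (simp add: orthogonal_transformation_norm[OF P(1)])
    have "?a - ?b = (x - y) + \<epsilon> *\<^sub>R (h - P h)" by (simp add: algebra_simps)
    then have "sqrt (norm (?a - ?b)) \<le> sqrt t * (1 + (\<epsilon>/t) * ((h - P h) \<bullet> e) / 2 + (\<epsilon>/t)\<^sup>2)"
      unfolding xy using sqrt_norm_expansion(2)[OF e v t \<epsilon>(1,2)] by simp
    then have "C * sqrt (norm (?a - ?b)) \<le> C * (sqrt t * (1 + (\<epsilon>/t) * ((h - P h) \<bullet> e) / 2 + (\<epsilon>/t)\<^sup>2))"
      using C by (rule mult_left_mono)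
    moreover have ax: "?a - x\<^sub>0 = (x - x\<^sub>0) + \<epsilon> *\<^sub>R h" by simp
    have "M * (norm (?a - x\<^sub>0))\<^sup>2 \<le> M * ((norm (x - x\<^sub>0))\<^sup>2 + 3 * \<epsilon>)"
      unfolding ax using norm_add_scaleR_power2_le[OF x, of h \<epsilon>] h \<epsilon> M by (intro mult_left_mono) auto
    ultimately have "u ?a - u ?b \<le> \<theta> + C * (sqrt t * (1 + (\<epsilon>/t) * ((h - P h) \<bullet> e) / 2 + (\<epsilon>/t)\<^sup>2))
      + M * ((norm (x - x\<^sub>0))\<^sup>2 + 3 * \<epsilon>)"
      using H[of ?a ?b] by linarith
    also have "\<dots> = ?Q h" using t by (simp add: field_simps inner_diff_left inner_diff_right inner_commute)
    finally show "u ?a - u ?b \<le> ?Q h" .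
  qed
  also have "integral\<^sup>L (step_measure p z) ?Q = (\<theta> + C * sqrt t * (1 + (\<epsilon>/t)\<^sup>2) + M * ((norm (x - x\<^sub>0))\<^sup>2 + 3 * \<epsilon>))
    + (C * sqrt t * (\<epsilon>/t) / 2) * ((\<integral>h. e \<bullet> h \<partial>step_measure p z) - (\<integral>h. e \<bullet> P h \<partial>step_measure p z))"
    by (rule step_integral_affine[OF z(1) i(2,1)])
  also have "(\<integral>h. e \<bullet> P h \<partial>step_measure p z) = (\<integral>h. e \<bullet> h \<partial>step_measure p w)"
    unfolding P(2)[symmetric] by (subst integral_step_measure_orthogonal[OF P(1)]) auto
  also have "(\<theta> + C * sqrt t * (1 + (\<epsilon>/t)\<^sup>2) + M * ((norm (x - x\<^sub>0))\<^sup>2 + 3 * \<epsilon>))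
    + (C * sqrt t * (\<epsilon>/t) / 2) * ((\<integral>h. e \<bullet> h \<partial>step_measure p z) - (\<integral>h. e \<bullet> h \<partial>step_measure p w))
    = \<theta> + C * (sqrt t * (1 + (\<epsilon>/t) * (drift TYPE('n) * ((z - w) \<bullet> e)) / 2 + (\<epsilon>/t)\<^sup>2))
    + M * ((norm (x - x\<^sub>0))\<^sup>2 + 3 * \<epsilon>)"
    unfolding step_integral_inner[OF z(1)] step_integral_inner[OF z(2)]
    using t by (simp add: field_simps inner_diff_left inner_diff_right inner_commute)
  finally show ?thesis .
qed

text \<open>Averaging the coupled steps for \<open>h\<close> and \<open>- h\<close> cancels the
  first-order terms. The reflection swapping \<open>z\<close> and \<open>w\<close> displaces along
  \<open>n\<close>, which is almost parallel to \<open>e\<close>; so the negative radial part of the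
  second-order term outweighs the positive part.\<close>

lemma avg_diff_le_symmetric:
  fixes e z w :: "real ^ 'n"
  assumes e: "norm e = 1" and z: "norm z = 1" "norm w = 1" and zw: "15/8 \<le> (z - w) \<bullet> e"
    and xy: "x - y = t *\<^sub>R e" and t: "0 < t" and \<epsilon>: "0 < \<epsilon>" "\<epsilon> \<le> t / 64"
    and C: "0 \<le> C" and M: "0 \<le> M"
    and H: "\<And>a b. u a - u b \<le> \<theta> + C * sqrt (norm (a - b)) + M * (norm (a - x\<^sub>0))\<^sup>2"
  shows "(avg p \<epsilon> z u x - avg p \<epsilon> w u y) / 2 + (avg p \<epsilon> (- z) u x - avg p \<epsilon> (- w) u y) / 2 \<le> \<theta>
    + C * (sqrt t * (1 - (\<epsilon>/t)\<^sup>2 * (drift TYPE('n))\<^sup>2 / 8 + 3 * (\<epsilon>/t) ^ 3))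
    + M * ((norm (x - x\<^sub>0))\<^sup>2 + \<epsilon>\<^sup>2)"
proof -
  let ?c = "drift TYPE('n)"
  have zw1: "15/8 \<le> norm (z - w)" using norm_cauchy_schwarz[of "z - w" e] e zw by simp
  then have ne: "z \<noteq> w" by auto
  define n where "n = (1 / norm (z - w)) *\<^sub>R (z - w)"
  have n: "norm n = 1" using ne by (simp add: n_def)
  have zw2: "norm (z - w) \<le> 2" using norm_triangle_ineq4[of z w] z by simp
  \<comment> \<open>Since \<open>norm (z - w)\<close> is at most 2, the threshold 15/8 gives
    \<open>n \<bullet> e \<ge> 15/16\<close>, whose square 225/256 just exceeds 7/8.\<close>
  have "(15/8) / 2 \<le> ((z - w) \<bullet> e) / norm (z - w)" using zw zw1 zw2 by (intro frac_le) auto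
  also have "\<dots> = n \<bullet> e" by (simp add: n_def)
  finally have "(15/16)\<^sup>2 \<le> (n \<bullet> e)\<^sup>2" by (intro power_mono) auto
  then have ne2: "7/8 \<le> (n \<bullet> e)\<^sup>2" by (simp add: power2_eq_square)
  have P: "orthogonal_transformation (reflection n)" "reflection n z = w"
    using orthogonal_transformation_reflection[OF n] reflection_swap[OF z ne] by (auto simp: n_def)
  have zz: "z \<bullet> z = 1" "w \<bullet> w = 1" using z by (simp_all add: norm_eq_1)
  \<comment> \<open>Now \<open>n \<bullet> z\<close> is half of \<open>norm (z - w)\<close>, hence
    at least 15/16; this bounds the second moment of \<open>n \<bullet> h\<close> from
    below.\<close>
  have "(norm (z - w))\<^sup>2 = 2 * ((z - w) \<bullet> z)"
    unfolding power2_norm_eq_inner using zz by (simp add: inner_diff_left inner_diff_right inner_commute)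
  then have "(z - w) \<bullet> z = norm (z - w) * norm (z - w) / 2" by (simp add: power2_eq_square)
  moreover have "n \<bullet> z = ((z - w) \<bullet> z) / norm (z - w)" by (simp add: n_def)
  ultimately have "n \<bullet> z = norm (z - w) / 2" using ne by simp
  then have "15/16 \<le> n \<bullet> z" using zw1 by simp
  then have "(?c * (15/16))\<^sup>2 \<le> (?c * (n \<bullet> z))\<^sup>2"
    using drift_bounds(1)[where 'n = 'n] by (intro power_mono mult_left_mono) auto
  also have "\<dots> \<le> (\<integral>h. (n \<bullet> h)\<^sup>2 \<partial>step_measure p z)" by (rule step_integral_inner_power2[OF z(1)])
  finally have var: "?c\<^sup>2 * (225/256) \<le> (\<integral>h. (n \<bullet> h)\<^sup>2 \<partial>step_measure p z)"
    by (simp add: power2_eq_square)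
  note R = borel_measurable_orthogonal[OF P(1)]
  note mi = shift_integrable[OF z(1)]
  have um: "orthogonal_transformation (\<lambda>h :: real ^ 'n. - h)"
    unfolding orthogonal_transformation_neg by simp
  have P': "orthogonal_transformation (\<lambda>h. - reflection n h)" "(\<lambda>h. - reflection n h) z = - w"
    using P by (auto simp: orthogonal_transformation_neg)
  have R': "(\<lambda>h. - reflection n h) \<in> borel_measurable borel"
    by (rule borel_measurable_orthogonal[OF P'(1)])
  have i: "integrable (step_measure p z) (\<lambda>h. u (x + \<epsilon> *\<^sub>R h))"
    "integrable (step_measure p z) (\<lambda>h. u (y + \<epsilon> *\<^sub>R reflection n h))"
    "integrable (step_measure p z) (\<lambda>h. u (x + \<epsilon> *\<^sub>R (- h)))"
    "integrable (step_measure p z) (\<lambda>h. u (y + \<epsilon> *\<^sub>R (- reflection n h)))"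
    using mi[of "\<lambda>h. h"] mi[OF R] mi[of "\<lambda>h. - h"] mi[OF R'] by auto
  have "(avg p \<epsilon> z u x - avg p \<epsilon> w u y) / 2 + (avg p \<epsilon> (- z) u x - avg p \<epsilon> (- w) u y) / 2
    = (\<integral>h. ((u (x + \<epsilon> *\<^sub>R h) - u (y + \<epsilon> *\<^sub>R reflection n h))
         + (u (x + \<epsilon> *\<^sub>R (- h)) - u (y + \<epsilon> *\<^sub>R (- reflection n h)))) / 2 \<partial>step_measure p z)"
    unfolding avg_orthogonal[OF P] avg_orthogonal[OF P'] avg_orthogonal[OF um, of z "- z", OF refl]
    using i by (simp add: avg_def[of p \<epsilon> z] add_divide_distrib diff_divide_distrib)
  also have "\<dots> \<le> (\<integral>h. (\<theta> + C * (sqrt t * (1 + 3 * (\<epsilon>/t) ^ 3)) + M * ((norm (x - x\<^sub>0))\<^sup>2 + \<epsilon>\<^sup>2))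
      - (C * sqrt t * (\<epsilon>/t)\<^sup>2 / 6) * (n \<bullet> h)\<^sup>2 \<partial>step_measure p z)" (is "_ \<le> integral\<^sup>L _ ?Q")
  proof (rule step_integral_mono[OF z(1)])
    show "integrable (step_measure p z) ?Q"
      by (intro Bochner_Integration.integrable_diff integrable_mult_right inner_power2_integrable[OF z(1)]
          finite_measure.integrable_const[OF finite_step_measure[OF z(1)]])
    fix h :: "real ^ 'n" assume h: "norm h < 1"
    define s where "s = n \<bullet> h"
    let ?a = "x + \<epsilon> *\<^sub>R h" and ?b = "y + \<epsilon> *\<^sub>R reflection n h"
      and ?a' = "x + \<epsilon> *\<^sub>R (- h)" and ?b' = "y + \<epsilon> *\<^sub>R (- reflection n h)"
    define v where "v = h - reflection n h"
    have v_eq: "v = (2 * s) *\<^sub>R n" by (simp add: v_def reflection_displacement[OF n] s_def)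
    have v: "norm v \<le> 2"
      using norm_triangle_ineq4[of h "reflection n h"] h by (simp add: v_def orthogonal_transformation_norm[OF P(1)])
    define X where "X = (\<epsilon>/t)\<^sup>2 * ((norm v)\<^sup>2 / 4 - (v \<bullet> e)\<^sup>2 / 3) + 3 * (\<epsilon>/t) ^ 3"
    have ab: "?a - ?b = t *\<^sub>R e + \<epsilon> *\<^sub>R v" "?a' - ?b' = t *\<^sub>R e + \<epsilon> *\<^sub>R (- v)"
      using xy by (simp_all add: v_def algebra_simps)
    have "sqrt (norm (?a - ?b)) \<le> sqrt t * (1 + (\<epsilon>/t) * (v \<bullet> e) / 2 + X)"
      using sqrt_norm_expansion(1)[OF e v t \<epsilon>(1,2)] unfolding ab by (simp add: X_def algebra_simps)
    moreover have "sqrt (norm (?a' - ?b')) \<le> sqrt t * (1 - (\<epsilon>/t) * (v \<bullet> e) / 2 + X)"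
      using sqrt_norm_expansion(1)[OF e _ t \<epsilon>(1,2), of "- v"] v unfolding ab by (simp add: X_def algebra_simps)
    ultimately have "sqrt (norm (?a - ?b)) + sqrt (norm (?a' - ?b')) \<le> 2 * (sqrt t * (1 + X))"
      by (simp add: algebra_simps)
    also have "\<dots> \<le> 2 * (sqrt t * (1 + (3 * (\<epsilon>/t) ^ 3 - (\<epsilon>/t)\<^sup>2 * (s\<^sup>2 / 6))))"
    proof -
      have "(norm v)\<^sup>2 / 4 - (v \<bullet> e)\<^sup>2 / 3 = s\<^sup>2 * (1 - 4/3 * (n \<bullet> e)\<^sup>2)"
        by (simp add: v_eq n power_mult_distrib algebra_simps)
      also have "\<dots> \<le> s\<^sup>2 * (- 1/6)" using ne2 by (intro mult_left_mono) auto
      finally have "(\<epsilon>/t)\<^sup>2 * ((norm v)\<^sup>2 / 4 - (v \<bullet> e)\<^sup>2 / 3) \<le> (\<epsilon>/t)\<^sup>2 * - (s\<^sup>2 / 6)"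
        by (intro mult_left_mono) auto
      then have "1 + X \<le> 1 + (3 * (\<epsilon>/t) ^ 3 - (\<epsilon>/t)\<^sup>2 * (s\<^sup>2 / 6))" by (simp add: X_def)
      then show ?thesis using t by (intro mult_left_mono) auto
    qed
    finally have "C * (sqrt (norm (?a - ?b)) + sqrt (norm (?a' - ?b')))
      \<le> C * (2 * (sqrt t * (1 + (3 * (\<epsilon>/t) ^ 3 - (\<epsilon>/t)\<^sup>2 * (s\<^sup>2 / 6)))))"
      using C by (rule mult_left_mono)
    note F1 = this
    \<comment> \<open>Parallelogram identity: opposite steps raise the quadratic penalty only by
      order \<open>\<epsilon>\<^sup>2\<close>.\<close>
    have "(norm (?a - x\<^sub>0))\<^sup>2 + (norm (?a' - x\<^sub>0))\<^sup>2 \<le> 2 * ((norm (x - x\<^sub>0))\<^sup>2 + \<epsilon>\<^sup>2)"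
    proof -
      have "?a - x\<^sub>0 = (x - x\<^sub>0) + \<epsilon> *\<^sub>R h" "?a' - x\<^sub>0 = (x - x\<^sub>0) - \<epsilon> *\<^sub>R h" by auto
      then have "(norm (?a - x\<^sub>0))\<^sup>2 + (norm (?a' - x\<^sub>0))\<^sup>2 = 2 * ((norm (x - x\<^sub>0))\<^sup>2 + \<epsilon>\<^sup>2 * (norm h)\<^sup>2)"
        unfolding power2_norm_eq_inner
        by (simp add: inner_add_left inner_add_right inner_diff_left inner_diff_right power2_eq_square algebra_simps)
      also have "\<epsilon>\<^sup>2 * (norm h)\<^sup>2 \<le> \<epsilon>\<^sup>2 * 1" using h by (intro mult_left_mono power_le_one) auto
      finally show ?thesis by simp
    qed
    then have "M * ((norm (?a - x\<^sub>0))\<^sup>2 + (norm (?a' - x\<^sub>0))\<^sup>2) \<le> M * (2 * ((norm (x - x\<^sub>0))\<^sup>2 + \<epsilon>\<^sup>2))"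
      using M by (rule mult_left_mono)
    note F2 = this
    have arith: "((a - b) + (a' - b')) / 2 \<le> \<theta> + C * Y + M * Z"
      if "C * (r + r') \<le> C * (2 * Y)" "M * (m + m') \<le> M * (2 * Z)"
        "a - b \<le> \<theta> + C * r + M * m" "a' - b' \<le> \<theta> + C * r' + M * m'"
      for a b a' b' r r' m m' Y Z :: real
      using that by (simp add: algebra_simps)
    have "((u ?a - u ?b) + (u ?a' - u ?b')) / 2 \<le> \<theta>
      + C * (sqrt t * (1 + (3 * (\<epsilon>/t) ^ 3 - (\<epsilon>/t)\<^sup>2 * (s\<^sup>2 / 6)))) + M * ((norm (x - x\<^sub>0))\<^sup>2 + \<epsilon>\<^sup>2)"
      by (rule arith[OF F1 F2 H H])
    also have "\<dots> = ?Q h" by (simp add: s_def algebra_simps)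
    finally show "((u ?a - u ?b) + (u ?a' - u ?b')) / 2 \<le> ?Q h" .
  qed (use i in auto)
  also have "\<dots> = (\<theta> + C * (sqrt t * (1 + 3 * (\<epsilon>/t) ^ 3)) + M * ((norm (x - x\<^sub>0))\<^sup>2 + \<epsilon>\<^sup>2))
      - (C * sqrt t * (\<epsilon>/t)\<^sup>2 / 6) * (\<integral>h. (n \<bullet> h)\<^sup>2 \<partial>step_measure p z)"
    by (subst Bochner_Integration.integral_diff, rule finite_measure.integrable_const[OF finite_step_measure[OF z(1)]],
        intro integrable_mult_right inner_power2_integrable[OF z(1)])
      (simp add: integral_step_measure_const[OF z(1)] del: lebesgue_integral_const)
  \<comment> \<open>The factor 225/256 is rounded down to 3/4, and
    \<open>1/6 * 3/4 = 1/8\<close>.\<close>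
  also have "\<dots> \<le> (\<theta> + C * (sqrt t * (1 + 3 * (\<epsilon>/t) ^ 3)) + M * ((norm (x - x\<^sub>0))\<^sup>2 + \<epsilon>\<^sup>2))
      - (C * sqrt t * (\<epsilon>/t)\<^sup>2 / 6) * (?c\<^sup>2 * (3/4))"
    using var C t by (intro diff_left_mono mult_left_mono order_trans[OF _ var]) (auto simp: power2_eq_square)
  also have "\<dots> = \<theta> + C * (sqrt t * (1 - (\<epsilon>/t)\<^sup>2 * ?c\<^sup>2 / 8 + 3 * (\<epsilon>/t) ^ 3)) + M * ((norm (x - x\<^sub>0))\<^sup>2 + \<epsilon>\<^sup>2)"
    by (simp add: algebra_simps)
  finally show ?thesis .
qed


text \<open>The step \<open>h\<close> from \<open>x\<close> and the step
  \<open>\<tau> *\<^sub>R z + h\<close> from \<open>y\<close> end at the same point. On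
  \<open>D\<close> the gaps \<open>U - u\<close> and \<open>u - L\<close> there add up to
  \<open>W\<close>; elsewhere within reach of a step they are nonnegative. So a fraction
  \<open>overlap\<close> of \<open>W\<close> is gained.\<close>

lemma avg_diff_le_overlap:
  fixes z :: "real ^ 'n"
  assumes z: "norm z = 1" and \<epsilon>: "0 < \<epsilon>"
    and xy: "x - y = t *\<^sub>R z" and t: "0 \<le> t" "t \<le> \<epsilon>/2"
    and W: "\<And>a b. norm (a - x) \<le> \<epsilon> \<Longrightarrow> norm (b - y) \<le> \<epsilon> \<Longrightarrow> u a - u b \<le> W"
  shows "avg p \<epsilon> z u x - avg p \<epsilon> z u y \<le> (1 - overlap TYPE('n)) * W"
proof -
  let ?\<mu> = "step_measure p z"
  define U where "U = (SUP a\<in>{a. norm (a - x) \<le> \<epsilon>}. u a)"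
  \<comment> \<open>As \<open>W\<close> bounds \<open>u a - u b\<close> for all reachable
    \<open>a\<close> and \<open>b\<close>, this lies below every value of \<open>u\<close> reachable
    from \<open>y\<close>.\<close>
  define L where "L = U - W"
  have bdd: "bdd_above (u ` {a. norm (a - x) \<le> \<epsilon>})"
    using u_bound by (intro bdd_aboveI[where M = 1]) (auto simp: abs_le_iff)
  have U: "u a \<le> U" if "norm (a - x) \<le> \<epsilon>" for a
    unfolding U_def using that bdd by (intro cSUP_upper) auto
  have L: "L \<le> u b" if "norm (b - y) \<le> \<epsilon>" for b
  proof -
    have "U \<le> W + u b"
      unfolding U_def
    proof (rule cSUP_least)
      show "{a. norm (a - x) \<le> \<epsilon>} \<noteq> {}" using \<epsilon> by (auto intro!: exI[of _ x])
    qed (use W[OF _ that] in force)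
    then show ?thesis by (simp add: L_def)
  qed
  define \<tau> where "\<tau> = t / \<epsilon>"
  have \<tau>: "0 \<le> \<tau>" "\<tau> \<le> 1/2" "t = \<epsilon> * \<tau>" using t \<epsilon> by (auto simp: \<tau>_def field_simps)
  define D where "D = ball ((1/4) *\<^sub>R z) (1/4)"
  \<comment> \<open>As \<open>\<tau> \<le> 1/2\<close>, the shifted ball still fits into the half
    ball: \<open>1/4 + 1/2 + 1/4 = 1\<close>.\<close>
  define D' where "D' = ball ((1/4 + \<tau>) *\<^sub>R z) (1/4)"
  have [measurable]: "D \<in> sets borel" "D' \<in> sets borel" by (auto simp: D_def D'_def)
  have DD': "\<tau> *\<^sub>R z + h \<in> D' \<longleftrightarrow> h \<in> D" for h
    by (simp add: D_def D'_def dist_norm algebra_simps)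
  have i: "integrable ?\<mu> (\<lambda>h. u (x' + \<epsilon> *\<^sub>R h))" for x' by (rule shift_integrable[OF z, of "\<lambda>h. h"]) simp
  have iD: "integrable lborel (\<lambda>h. indicator D h * (a + b * u (x + \<epsilon> *\<^sub>R h)))" for a b :: real
  proof (rule Bochner_Integration.integrable_bound)
    show "integrable lborel (\<lambda>h. (\<bar>a\<bar> + \<bar>b\<bar>) * indicator D h :: real)"
      unfolding D_def by (intro integrable_mult_right integrable_indicator_ball)
    have "\<bar>a + b * u h\<bar> \<le> \<bar>a\<bar> + \<bar>b\<bar>" for h
      using abs_triangle_ineq[of a "b * u h"] mult_left_le[OF u_bound[of h], of "\<bar>b\<bar>"] by (simp add: abs_mult)
    then show "AE h in lborel. norm (indicator D h * (a + b * u (x + \<epsilon> *\<^sub>R h))) \<le> norm ((\<bar>a\<bar> + \<bar>b\<bar>) * indicator D h)"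
      by (auto split: split_indicator)
  qed measurable
  have "(LINT h|lborel. indicator D h * (U - u (x + \<epsilon> *\<^sub>R h))) / mass p z \<le> (\<integral>h. U - u (x + \<epsilon> *\<^sub>R h) \<partial>?\<mu>)"
    unfolding D_def
  proof (rule step_integral_ge[OF z, where B = "\<bar>U\<bar> + 1"])
    show "\<bar>U - u (x + \<epsilon> *\<^sub>R h)\<bar> \<le> \<bar>U\<bar> + 1" for h
      using abs_triangle_ineq4[of U "u (x + \<epsilon> *\<^sub>R h)"] u_bound[of "x + \<epsilon> *\<^sub>R h"] by linarith
    show "0 \<le> U - u (x + \<epsilon> *\<^sub>R h)" if "norm h < 1" for h using U[of "x + \<epsilon> *\<^sub>R h"] that \<epsilon> by simp
    show "norm h < 1 \<and> 0 < z \<bullet> h" if "h \<in> ball ((1/4) *\<^sub>R z) (1/4)" for h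
      using near_direction[OF z _ that] by simp
  qed measurable
  also have "\<dots> = U - avg p \<epsilon> z u x"
    using i finite_measure.integrable_const[OF finite_step_measure[OF z], of U]
    by (simp add: avg_def integral_step_measure_const[OF z] del: lebesgue_integral_const)
  finally have 1: "(LINT h|lborel. indicator D h * (U - u (x + \<epsilon> *\<^sub>R h))) / mass p z \<le> U - avg p \<epsilon> z u x" .
  have "(LINT h|lborel. indicator D' h * (u (y + \<epsilon> *\<^sub>R h) - L)) / mass p z \<le> (\<integral>h. u (y + \<epsilon> *\<^sub>R h) - L \<partial>?\<mu>)"
    unfolding D'_def
  proof (rule step_integral_ge[OF z, where B = "\<bar>L\<bar> + 1"])
    show "\<bar>u (y + \<epsilon> *\<^sub>R h) - L\<bar> \<le> \<bar>L\<bar> + 1" for h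
      using abs_triangle_ineq4[of "u (y + \<epsilon> *\<^sub>R h)" L] u_bound[of "y + \<epsilon> *\<^sub>R h"] by linarith
    show "0 \<le> u (y + \<epsilon> *\<^sub>R h) - L" if "norm h < 1" for h using L[of "y + \<epsilon> *\<^sub>R h"] that \<epsilon> by simp
    show "norm h < 1 \<and> 0 < z \<bullet> h" if "h \<in> ball ((1/4 + \<tau>) *\<^sub>R z) (1/4)" for h
      using near_direction[OF z _ that] \<tau> by simp
  qed measurable
  also have "\<dots> = avg p \<epsilon> z u y - L"
    using i finite_measure.integrable_const[OF finite_step_measure[OF z], of L]
    by (simp add: avg_def integral_step_measure_const[OF z] del: lebesgue_integral_const)
  also have "(LINT h|lborel. indicator D' h * (u (y + \<epsilon> *\<^sub>R h) - L))
    = (LINT h|distr lborel borel ((+) (\<tau> *\<^sub>R z)). indicator D' h * (u (y + \<epsilon> *\<^sub>R h) - L))"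
    by (simp add: lborel_distr_plus)
  also have "\<dots> = (LINT h|lborel. indicator D' (\<tau> *\<^sub>R z + h) * (u (y + \<epsilon> *\<^sub>R (\<tau> *\<^sub>R z + h)) - L))"
    by (rule integral_distr) measurable
  also have "\<dots> = (LINT h|lborel. indicator D h * (u (x + \<epsilon> *\<^sub>R h) - L))"
  proof (rule Bochner_Integration.integral_cong[OF refl])
    fix h
    have "y + \<epsilon> *\<^sub>R (\<tau> *\<^sub>R z + h) = y + (x - y) + \<epsilon> *\<^sub>R h" unfolding xy \<tau>(3) by (simp add: algebra_simps)
    then have "y + \<epsilon> *\<^sub>R (\<tau> *\<^sub>R z + h) = x + \<epsilon> *\<^sub>R h" by simp
    moreover have "indicator D' (\<tau> *\<^sub>R z + h) = (indicator D h :: real)" by (simp add: indicator_def DD')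
    ultimately show "indicator D' (\<tau> *\<^sub>R z + h) * (u (y + \<epsilon> *\<^sub>R (\<tau> *\<^sub>R z + h)) - L) = indicator D h * (u (x + \<epsilon> *\<^sub>R h) - L)"
      by simp
  qed
  finally have 2: "(LINT h|lborel. indicator D h * (u (x + \<epsilon> *\<^sub>R h) - L)) / mass p z \<le> avg p \<epsilon> z u y - L" .
  have "(LINT h|lborel. indicator D h * (U - u (x + \<epsilon> *\<^sub>R h))) + (LINT h|lborel. indicator D h * (u (x + \<epsilon> *\<^sub>R h) - L))
    = (LINT h|lborel. indicator D h * (U - u (x + \<epsilon> *\<^sub>R h)) + indicator D h * (u (x + \<epsilon> *\<^sub>R h) - L))"
    using iD[of U "-1"] iD[of "- L" 1] by simp
  also have "\<dots> = (LINT h|lborel. W * indicator D h)"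
    by (rule Bochner_Integration.integral_cong[OF refl]) (simp add: L_def algebra_simps)
  also have "\<dots> = W * measure lborel (ball (0 :: real ^ 'n) (1/4))"
    by (simp add: D_def measure_ball_translate[of "(1/4) *\<^sub>R z"])
  finally have 3: "(LINT h|lborel. indicator D h * (U - u (x + \<epsilon> *\<^sub>R h)))
      + (LINT h|lborel. indicator D h * (u (x + \<epsilon> *\<^sub>R h) - L))
    = W * measure lborel (ball (0 :: real ^ 'n) (1/4))" .
  have "W * overlap TYPE('n) \<le> (U - avg p \<epsilon> z u x) + (avg p \<epsilon> z u y - L)"
    using add_mono[OF 1 2] mass_eq[of "axis undefined 1" z p] z
    unfolding add_divide_distrib[symmetric] 3 by (simp add: overlap_def)
  then show ?thesis by (simp add: L_def algebra_simps)
qed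

text \<open>The pair \<open>(z, w)\<close> decides the answer: concavity wins if it is almost
  \<open>(e, -e)\<close>, drift wins otherwise. In both cases the gain pays for the quadratic
  penalty, the source term and a further \<open>\<epsilon>\<^sup>2\<close>.\<close>

lemma large_distance_step:
  fixes e z w :: "real ^ 'n"
  assumes e: "norm e = 1" and z: "norm z = 1" "norm w = 1"
    and xy: "x - y = t *\<^sub>R e" and t: "0 < t" "t \<le> 1"
    and \<epsilon>: "0 < \<epsilon>" "64 * \<epsilon> \<le> (drift TYPE('n))\<^sup>2 * t"
    and x: "norm (x - x\<^sub>0) \<le> 1" and M: "0 \<le> M" and C: "64 * (3 * M + 4) \<le> C * (drift TYPE('n))\<^sup>2"
    and H: "\<And>a b. u a - u b \<le> \<theta> + C * sqrt (norm (a - b)) + M * (norm (a - x\<^sub>0))\<^sup>2"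
    and dpp: "\<And>z' w'. norm z' = 1 \<Longrightarrow> norm w' = 1 \<Longrightarrow>
      u x - u y \<le> (avg p \<epsilon> z u x - avg p \<epsilon> w u y) / 2 + (avg p \<epsilon> z' u x - avg p \<epsilon> w' u y) / 2 + 3 * \<epsilon>\<^sup>2"
  shows "u x - u y \<le> \<theta> - \<epsilon>\<^sup>2 + C * sqrt t + M * (norm (x - x\<^sub>0))\<^sup>2"
proof -
  define c where "c = drift TYPE('n)"
  have c: "0 < c" "c \<le> 1" using drift_bounds[where 'n = 'n] by (auto simp: c_def)
  note \<epsilon> = \<epsilon>[folded c_def] and C = C[folded c_def]
  have c2: "c\<^sup>2 \<le> c" "c\<^sup>2 \<le> 1"
    using c power_le_one[of c 2] mult_left_le[of c c] by (auto simp: power2_eq_square)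
  have "0 < 64 * (3 * M + 4)" using M by simp
  then have "0 < C * c\<^sup>2" using C by (rule less_le_trans)
  then have C0: "0 \<le> C" using c by (simp add: zero_less_mult_iff)
  have "c\<^sup>2 * t \<le> 1 * t" using c2 t by (intro mult_right_mono) auto
  then have \<epsilon>t: "\<epsilon> \<le> t / 64" using \<epsilon> by simp
  then have \<epsilon>1: "\<epsilon> \<le> 1" using t by simp
  define d where "d = \<epsilon> / t"
  have d: "0 < d" "d \<le> c\<^sup>2 / 64" using \<epsilon> t by (auto simp: d_def field_simps)
  \<comment> \<open>With \<open>\<epsilon> = t * d\<close> and \<open>t \<le> 1\<close>, gains of
    size \<open>sqrt t * d\<close> and \<open>sqrt t * d\<^sup>2\<close> dominate
    \<open>\<epsilon>\<close> and \<open>\<epsilon>\<^sup>2\<close>.\<close>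
  have "t \<le> sqrt t" using t real_le_rsqrt[of t t] by (simp add: power2_eq_square mult_left_le)
  then have s1: "\<epsilon> \<le> sqrt t * d" and s2: "\<epsilon>\<^sup>2 \<le> sqrt t * d\<^sup>2"
  proof -
    assume ts: "t \<le> sqrt t"
    show "\<epsilon> \<le> sqrt t * d" using mult_right_mono[OF ts, of d] d t by (simp add: d_def)
    have "t * t \<le> sqrt t" using ts t mult_left_le[of t t] by linarith
    then show "\<epsilon>\<^sup>2 \<le> sqrt t * d\<^sup>2"
      using mult_right_mono[of "t * t" "sqrt t" "d\<^sup>2"] t by (simp add: d_def power2_eq_square)
  qed
  show ?thesis
  proof (cases "15/8 \<le> (z - w) \<bullet> e")
    case True
    have "u x - u y \<le> \<theta> + C * (sqrt t * (1 - d\<^sup>2 * c\<^sup>2 / 8 + 3 * d ^ 3)) + M * ((norm (x - x\<^sub>0))\<^sup>2 + \<epsilon>\<^sup>2) + 3 * \<epsilon>\<^sup>2"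
      using dpp[of "- z" "- w"] z avg_diff_le_symmetric[OF e z True xy t(1) \<epsilon>(1) \<epsilon>t C0 M H]
      by (simp add: c_def d_def)
    also have "\<dots> \<le> \<theta> + (C * sqrt t - (M + 4) * \<epsilon>\<^sup>2) + M * ((norm (x - x\<^sub>0))\<^sup>2 + \<epsilon>\<^sup>2) + 3 * \<epsilon>\<^sup>2"
    proof -
      \<comment> \<open>As \<open>d \<le> c\<^sup>2 / 64\<close>, the cubic remainder uses up at
        most half of the concavity gain.\<close>
      have "d\<^sup>2 * (3 * d) \<le> d\<^sup>2 * (c\<^sup>2 / 16)" using d by (intro mult_left_mono) auto
      then have "1 - d\<^sup>2 * c\<^sup>2 / 8 + 3 * d ^ 3 \<le> 1 - d\<^sup>2 * c\<^sup>2 / 16" by (simp add: power2_eq_square power3_eq_cube)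
      then have "C * (sqrt t * (1 - d\<^sup>2 * c\<^sup>2 / 8 + 3 * d ^ 3)) \<le> C * (sqrt t * (1 - d\<^sup>2 * c\<^sup>2 / 16))"
        using C0 t by (intro mult_left_mono) auto
      also have "\<dots> = C * sqrt t - (C * c\<^sup>2 / 16) * (sqrt t * d\<^sup>2)" by (simp add: algebra_simps)
      also have "\<dots> \<le> C * sqrt t - (M + 4) * \<epsilon>\<^sup>2"
        using C M s2 by (intro diff_left_mono mult_mono) auto
      finally show ?thesis by simp
    qed
    also have "\<dots> = \<theta> - \<epsilon>\<^sup>2 + C * sqrt t + M * (norm (x - x\<^sub>0))\<^sup>2" by (simp add: algebra_simps)
    finally show ?thesis .
  next
    case False
    define s where "s = (z - w) \<bullet> e"
    have "norm (- e) = 1" using e by simp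
    moreover have "(- e - e) \<bullet> e = - 2" using e by (simp only: inner_diff_left inner_minus_left dot_square_norm) simp
    ultimately have pull: "avg p \<epsilon> (- e) u x - avg p \<epsilon> e u y \<le> \<theta> + C * (sqrt t * (1 + d * (c * (- 2)) / 2 + d\<^sup>2))
      + M * ((norm (x - x\<^sub>0))\<^sup>2 + 3 * \<epsilon>)"
      using avg_diff_le_drift[OF e _ e xy t(1) \<epsilon>(1) \<epsilon>t \<epsilon>1 x C0 M H, of "- e"] by (simp add: c_def d_def)
    have "avg p \<epsilon> z u x - avg p \<epsilon> w u y \<le> \<theta> + C * (sqrt t * (1 + d * (c * s) / 2 + d\<^sup>2))
      + M * ((norm (x - x\<^sub>0))\<^sup>2 + 3 * \<epsilon>)"
      using avg_diff_le_drift[OF e z xy t(1) \<epsilon>(1) \<epsilon>t \<epsilon>1 x C0 M H] by (simp add: c_def d_def s_def)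
    then have "u x - u y \<le> \<theta> + (C * (sqrt t * (1 + d * (c * s) / 2 + d\<^sup>2)) + C * (sqrt t * (1 + d * (c * (- 2)) / 2 + d\<^sup>2))) / 2
      + M * ((norm (x - x\<^sub>0))\<^sup>2 + 3 * \<epsilon>) + 3 * \<epsilon>\<^sup>2"
      using dpp[of "- e" e] e pull by (simp add: field_simps)
    also have "\<dots> = \<theta> + C * (sqrt t * (1 + d * (c * (s - 2) / 4 + d))) + M * ((norm (x - x\<^sub>0))\<^sup>2 + 3 * \<epsilon>) + 3 * \<epsilon>\<^sup>2"
      by (simp add: power2_eq_square field_simps)
    also have "\<dots> \<le> \<theta> + (C * sqrt t - (3 * M + 4) * \<epsilon>) + M * ((norm (x - x\<^sub>0))\<^sup>2 + 3 * \<epsilon>) + 3 * \<epsilon>\<^sup>2"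
    proof -
      \<comment> \<open>Below the threshold 15/8 the net first-order coefficient
        \<open>c * (s - 2) / 4\<close> is at most \<open>- c / 32\<close>, and the second-order term
        \<open>d \<le> c\<^sup>2 / 64\<close> takes at most half of it.\<close>
      have "c * (s - 2) \<le> c * (- 1/8)" using False c by (intro mult_left_mono) (auto simp: s_def)
      then have "d * (c * (s - 2) / 4 + d) \<le> d * (- (c\<^sup>2 / 64))"
        using d c2 by (intro mult_left_mono) auto
      then have "C * (sqrt t * (1 + d * (c * (s - 2) / 4 + d))) \<le> C * (sqrt t * (1 + d * (- (c\<^sup>2 / 64))))"
        using C0 t by (intro mult_left_mono) auto
      also have "\<dots> = C * sqrt t - (C * c\<^sup>2 / 64) * (sqrt t * d)" by (simp add: algebra_simps)
      also have "\<dots> \<le> C * sqrt t - (3 * M + 4) * \<epsilon>"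
        using C M s1 \<epsilon> by (intro diff_left_mono mult_mono) auto
      finally show ?thesis by simp
    qed
    \<comment> \<open>What is left is \<open>3 * \<epsilon>\<^sup>2 - 4 * \<epsilon>\<close>, at
      most \<open>- \<epsilon>\<^sup>2\<close> because \<open>\<epsilon> \<le> 1\<close>.\<close>
    also have "\<dots> \<le> \<theta> - \<epsilon>\<^sup>2 + C * sqrt t + M * (norm (x - x\<^sub>0))\<^sup>2"
      using mult_left_le[OF \<epsilon>1, of \<epsilon>] \<epsilon>(1) by (simp add: algebra_simps power2_eq_square)
    finally show ?thesis .
  qed
qed

end

end

subsection \<open>The comparison argument\<close>

text \<open>The distance grows by at most \<open>2 * \<epsilon>\<close>; rounding up to
  \<open>4 * \<epsilon>\<close> gives a clean square root, and the square root is
  subadditive.\<close>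

lemma sqrt_norm_add_le:
  assumes "norm (a - x) \<le> \<epsilon>" "norm (b - y) \<le> \<epsilon>"
  shows "sqrt (norm (a - b)) \<le> sqrt (norm (x - y)) + 2 * sqrt \<epsilon>"
proof -
  have "a - b = (x - y) + (a - x) - (b - y)" by simp
  then have "norm (a - b) \<le> norm (x - y) + norm (a - x) + norm (b - y)"
    by (metis norm_triangle_ineq norm_triangle_ineq4 add_right_mono order_trans)
  then have "norm (a - b) \<le> norm (x - y) + 4 * \<epsilon>" using assms norm_ge_zero[of "a - x"] by linarith
  then have "sqrt (norm (a - b)) \<le> sqrt (norm (x - y) + 4 * \<epsilon>)" by simp
  also have "\<dots> \<le> sqrt (norm (x - y)) + sqrt (4 * \<epsilon>)"
    using order_trans[OF norm_ge_zero assms(1)] by (intro sqrt_add_le_add_sqrt) auto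
  also have "sqrt (4 * \<epsilon>) = 2 * sqrt \<epsilon>" by (simp add: real_sqrt_mult)
  finally show ?thesis .
qed

lemma unit_direction:
  fixes x y :: "real ^ 'n"
  obtains e :: "real ^ 'n" where "norm e = 1" "x - y = norm (x - y) *\<^sub>R e"
proof (cases "x = y")
  case True
  then show ?thesis using that[of "axis undefined 1"] by simp
next
  case False
  then show ?thesis using that[of "(1 / norm (x - y)) *\<^sub>R (x - y)"] by simp
qed

lemma square_le_sqrt:
  assumes "0 \<le> \<epsilon>" "\<epsilon> \<le> (1::real)"
  shows "\<epsilon>\<^sup>2 \<le> sqrt \<epsilon>" "\<epsilon> \<le> sqrt \<epsilon>"
proof -
  show *: "\<epsilon> \<le> sqrt \<epsilon>"
    using assms by (intro real_le_rsqrt) (simp add: power2_eq_square mult_left_le)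
  have "\<epsilon>\<^sup>2 \<le> \<epsilon>" using assms by (simp add: power2_eq_square mult_left_le)
  then show "\<epsilon>\<^sup>2 \<le> sqrt \<epsilon>" using * by linarith
qed

text \<open>The distance \<open>s\<close> is measured in units of \<open>\<epsilon>\<close>. The 4
  in the exponent matches the decrease by 1/4 that \<open>avg_diff_le_pull\<close> exploits: each
  such decrease multiplies the penalty by \<open>\<rho>\<close>. At \<open>s = K\<close> it jumps
  from about \<open>A\<close> to 0.\<close>

definition step_penalty :: "real \<Rightarrow> real \<Rightarrow> real \<Rightarrow> real \<Rightarrow> real" where
  "step_penalty A \<rho> K s = (if s < K then A * \<rho> powr (4 * (K - s)) else 0)"

lemma step_penalty_nonneg: "0 \<le> A \<Longrightarrow> 0 \<le> step_penalty A \<rho> K s"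
  by (simp add: step_penalty_def)

lemma step_penalty_antimono:
  assumes "0 \<le> A" "1 \<le> \<rho>" "s \<le> s'"
  shows "step_penalty A \<rho> K s' \<le> step_penalty A \<rho> K s"
  using assms by (auto simp: step_penalty_def intro!: mult_left_mono powr_mono)

lemma step_penalty_shift:
  assumes "0 \<le> A" "1 \<le> \<rho>" "s < K"
  shows "step_penalty A \<rho> K (s - 1/4) = \<rho> * step_penalty A \<rho> K s" "A \<le> step_penalty A \<rho> K s"
proof -
  have "\<rho> powr (4 * (K - (s - 1/4))) = \<rho> powr (1 + 4 * (K - s))" by (simp add: algebra_simps)
  also have "\<dots> = \<rho> * \<rho> powr (4 * (K - s))" using assms by (simp add: powr_add)
  finally show "step_penalty A \<rho> K (s - 1/4) = \<rho> * step_penalty A \<rho> K s"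
    using assms by (simp add: step_penalty_def)
  have "A * 1 \<le> A * \<rho> powr (4 * (K - s))"
    using assms by (intro mult_left_mono ge_one_powr_ge_zero) auto
  then show "A \<le> step_penalty A \<rho> K s" using assms by (simp add: step_penalty_def)
qed

context singular_exponent
begin

text \<open>For \<open>comparison\<close>, where it makes \<open>\<rho> = 4 / \<kappa>\<close> at
  least 1 and thereby the correction monotone.\<close>

lemma pull_le_1: "pull TYPE('n::finite) \<le> 1"
proof -
  define z :: "real ^ 'n" where "z = axis undefined 1"
  have z: "norm z = 1" by (simp add: z_def)
  interpret finite_measure "step_measure p z" by (rule finite_step_measure[OF z])
  have "measure (step_measure p z) {h. 1/8 < z \<bullet> h \<and> z \<bullet> h < 1/4} \<le> measure (step_measure p z) UNIV"
    using bounded_measure by simp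
  also have "\<dots> = 1" by (simp add: measure_def emeasure_step_measure_UNIV[OF z])
  finally show ?thesis using pull_le[OF z] by linarith
qed

text \<open>The comparison function is \<open>C * sqrt |a - b| + M * |a - x\<^sub>0|\<^sup>2\<close> minus a correction which
  is supported in \<open>|a - b| < K * \<epsilon>\<close>, where the second-order expansion is useless. There the correction
  grows geometrically as \<open>|a - b|\<close> decreases, so that the probability \<^const>\<open>pull\<close> of getting closer
  outweighs everything else. The choice of \<open>M\<close> makes \<open>M * |a - x\<^sub>0|\<^sup>2 \<ge> 2\<close> once \<open>|a - x\<^sub>0| \<ge> 1/8\<close>,
  which localises the comparison.\<close>

lemma comparison:
  fixes u :: "real ^ 'n \<Rightarrow> real" and x\<^sub>0 y\<^sub>0 :: "real ^ 'n" and M C K A \<rho> \<Theta> \<epsilon> :: real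
  defines "c \<equiv> drift TYPE('n)" and "\<kappa> \<equiv> pull TYPE('n)" and "\<beta> \<equiv> overlap TYPE('n)"
  defines "M \<equiv> 128" and "C \<equiv> 64 * 388 / c\<^sup>2" and "K \<equiv> 64 / c\<^sup>2" and "A \<equiv> 2 * C + 3 * M + 4" and "\<rho> \<equiv> 4 / \<kappa>"
  defines "\<Theta> \<equiv> (2 / \<beta> + 1) * (A + step_penalty A \<rho> K 0)"
  assumes u_meas: "u \<in> borel_measurable borel" and u_bound: "\<And>x. \<bar>u x\<bar> \<le> 1"
    and \<epsilon>: "0 < \<epsilon>" "\<epsilon> \<le> 1 / (8 * K)"
    and x\<^sub>0: "x\<^sub>0 \<in> ball 0 (1/2)"
    and dpp: "\<And>x y. x \<in> ball 0 (7/8) \<Longrightarrow> y \<in> ball 0 (7/8) \<Longrightarrow>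
      \<exists>z w. norm z = 1 \<and> norm w = 1 \<and> (\<forall>z' w'. norm z' = 1 \<longrightarrow> norm w' = 1 \<longrightarrow>
      u x - u y \<le> (avg p \<epsilon> z u x - avg p \<epsilon> w u y) / 2 + (avg p \<epsilon> z' u x - avg p \<epsilon> w' u y) / 2 + 3 * \<epsilon>\<^sup>2)"
  shows "u x\<^sub>0 - u y\<^sub>0 \<le> \<Theta> * sqrt \<epsilon> + C * sqrt (norm (x\<^sub>0 - y\<^sub>0))"
proof -
  have c: "0 < c" "c \<le> 1" and \<kappa>: "0 < \<kappa>" "\<kappa> \<le> 1" and \<beta>: "0 < \<beta>"
    unfolding c_def \<kappa>_def \<beta>_def using drift_bounds pull_pos pull_le_1 overlap_pos by auto
  have c2: "0 < c\<^sup>2" "c\<^sup>2 \<le> 1" using c power_le_one[of c 2] by auto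
  have K: "64 \<le> K" and C: "64 * 388 \<le> C" using c2 by (auto simp: K_def C_def field_simps)
  have M: "0 \<le> M" by (simp add: M_def)
  have A: "4 \<le> A" using C M by (simp add: A_def)
  have \<rho>: "1 \<le> \<rho>" "\<kappa> * \<rho> = 4" using \<kappa> by (auto simp: \<rho>_def field_simps)
  define g where "g = step_penalty A \<rho> K"
  have g0: "0 \<le> g s" for s using step_penalty_nonneg[of A] A by (simp add: g_def)
  have g_anti: "g s' \<le> g s" if "s \<le> s'" for s s' using step_penalty_antimono A \<rho> that by (simp add: g_def)
  \<comment> \<open>Two demands fix \<open>\<Theta>\<close>: both \<open>\<Theta>\<close> and
    \<open>\<beta> * \<Theta> / 2\<close> must be at least \<open>A + g 0\<close>, the former to
    absorb the correction far away, the latter so that the overlap gain suffices near the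
    diagonal.\<close>
  have \<Theta>: "\<Theta> = (2 / \<beta>) * (A + g 0) + (A + g 0)" by (simp add: \<Theta>_def g_def algebra_simps)
  have \<Theta>1: "A + g 0 \<le> \<Theta>" unfolding \<Theta> using A g0[of 0] \<beta> by simp
  have "\<beta> * \<Theta> / 2 = (A + g 0) + \<beta> * (A + g 0) / 2" unfolding \<Theta> using \<beta> by (simp add: field_simps)
  then have \<Theta>2: "A + g 0 \<le> \<beta> * \<Theta> / 2" using A g0[of 0] \<beta> by simp
  have "1 / (8 * K) \<le> 1 / 512" using K by (intro divide_left_mono) auto
  then have \<epsilon>1: "\<epsilon> \<le> 1 / 512" using \<epsilon> by simp
  then have K\<epsilon>: "K * \<epsilon> \<le> 1/8" using \<epsilon> K by (simp add: field_simps)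
  have e2: "\<epsilon>\<^sup>2 \<le> sqrt \<epsilon>" and es: "\<epsilon> \<le> sqrt \<epsilon>" using square_le_sqrt[of \<epsilon>] \<epsilon> \<epsilon>1 by auto
  have se: "0 < sqrt \<epsilon>" using \<epsilon> by simp
  define f where "f a b = C * sqrt (norm (a - b)) + M * (norm (a - x\<^sub>0))\<^sup>2" for a b
  define G where "G a b = f a b - sqrt \<epsilon> * g (norm (a - b) / \<epsilon>)" for a b
  have f0: "0 \<le> f a b" for a b unfolding f_def using C M by simp
  have gG: "sqrt \<epsilon> * g (norm (a - b) / \<epsilon>) \<le> sqrt \<epsilon> * g 0" for a b
    using \<epsilon> by (intro mult_left_mono g_anti) auto
  have Gf: "G a b \<le> f a b" for a b unfolding G_def using g0 \<epsilon> by simp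
  \<comment> \<open>A valid bound with excess \<open>\<theta>\<close> improves by
    \<open>\<epsilon>\<^sup>2\<close> at every pair as long as \<open>\<theta>\<close> is at least
    \<open>\<Theta> * sqrt \<epsilon>\<close>. For the best possible \<open>\<theta>\<close> this is
    contradictory.\<close>
  have step: "u x - u y \<le> \<theta> - \<epsilon>\<^sup>2 + G x y"
    if \<theta>: "\<Theta> * sqrt \<epsilon> \<le> \<theta>" and H: "\<And>a b. u a - u b \<le> \<theta> + G a b" for x y \<theta>
  proof (cases "1/8 \<le> norm (x - x\<^sub>0) \<or> 1/8 \<le> norm (x - y)")
    case True
    \<comment> \<open>Far from \<open>x\<^sub>0\<close> or from the diagonal the comparison function
      alone exceeds the oscillation of \<open>u\<close>, which is at most 2.\<close>
    have "2 \<le> f x y"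
    proof (cases "1/8 \<le> norm (x - x\<^sub>0)")
      case True
      have "(1/8)\<^sup>2 \<le> (norm (x - x\<^sub>0))\<^sup>2" using True by (intro power_mono) auto
      then have "2 \<le> M * (norm (x - x\<^sub>0))\<^sup>2" by (simp add: M_def power2_eq_square)
      moreover have "0 \<le> C * sqrt (norm (x - y))" using C by simp
      ultimately show ?thesis unfolding f_def by linarith
    next
      case False
      then have "sqrt ((1/8)\<^sup>2) \<le> sqrt (norm (x - y))" using True by (intro real_sqrt_le_mono) (auto simp: power2_eq_square)
      then have "C * (1/8) \<le> C * sqrt (norm (x - y))" using C by (intro mult_left_mono) auto
      moreover have "0 \<le> M * (norm (x - x\<^sub>0))\<^sup>2" using M by simp
      ultimately show ?thesis using C unfolding f_def by linarith
    qed
    moreover have "(A + g 0) * sqrt \<epsilon> \<le> \<theta>" using mult_right_mono[OF \<Theta>1, of "sqrt \<epsilon>"] se \<theta> by linarith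
    then have "\<epsilon>\<^sup>2 + sqrt \<epsilon> * g 0 \<le> \<theta>"
      using e2 mult_right_mono[OF A, of "sqrt \<epsilon>"] se distrib_right[of A "g 0" "sqrt \<epsilon>"] mult.commute[of "g 0" "sqrt \<epsilon>"]
      by linarith
    moreover have "u x - u y \<le> 2" using u_bound[of x] u_bound[of y] by linarith
    ultimately show ?thesis using gG[of x y] unfolding G_def by linarith
  next
    case False
    define t where "t = norm (x - y)"
    have near: "norm (x - x\<^sub>0) < 1/8" "t < 1/8" using False by (auto simp: t_def)
    have "norm x \<le> norm (x - x\<^sub>0) + norm x\<^sub>0" "norm y \<le> norm (x - y) + norm x"
      using norm_triangle_ineq[of "x - x\<^sub>0" x\<^sub>0] norm_triangle_ineq4[of x "x - y"] by auto
    then have "x \<in> ball 0 (7/8)" "y \<in> ball 0 (7/8)" using x\<^sub>0 near by (auto simp: t_def)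
    from dpp[OF this] obtain z w where z: "norm z = 1" "norm w = 1"
      and dpp': "\<And>z' w'. norm z' = 1 \<Longrightarrow> norm w' = 1 \<Longrightarrow>
      u x - u y \<le> (avg p \<epsilon> z u x - avg p \<epsilon> w u y) / 2 + (avg p \<epsilon> z' u x - avg p \<epsilon> w' u y) / 2 + 3 * \<epsilon>\<^sup>2"
      by blast
    obtain e where e: "norm e = 1" and xy: "x - y = t *\<^sub>R e" using unit_direction[of x y] by (auto simp: t_def)
    have e': "norm (- e) = 1" using e by simp
    have t0: "0 \<le> t" by (simp add: t_def)
    \<comment> \<open>This bounds \<open>u a - u b\<close> wherever one step can lead, hence also
      the adversary's half of the average.\<close>
    define W where "W = \<theta> + f x y + (2 * C + 3 * M) * sqrt \<epsilon>"
    have fW: "f a b \<le> f x y + (2 * C + 3 * M) * sqrt \<epsilon>" if "norm (a - x) \<le> \<epsilon>" "norm (b - y) \<le> \<epsilon>" for a b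
    proof -
      have "C * sqrt (norm (a - b)) \<le> C * (sqrt (norm (x - y)) + 2 * sqrt \<epsilon>)"
        using sqrt_norm_add_le[OF that] C by (intro mult_left_mono) auto
      moreover have "(norm ((x - x\<^sub>0) + \<epsilon> *\<^sub>R ((1/\<epsilon>) *\<^sub>R (a - x))))\<^sup>2 \<le> (norm (x - x\<^sub>0))\<^sup>2 + 3 * \<epsilon>"
        by (rule norm_add_scaleR_power2_le) (use near that(1) \<epsilon>(1) \<epsilon>1 in \<open>simp_all add: pos_divide_le_eq\<close>)
      then have "(norm (a - x\<^sub>0))\<^sup>2 \<le> (norm (x - x\<^sub>0))\<^sup>2 + 3 * sqrt \<epsilon>" using \<epsilon> es by simp
      then have "M * (norm (a - x\<^sub>0))\<^sup>2 \<le> M * ((norm (x - x\<^sub>0))\<^sup>2 + 3 * sqrt \<epsilon>)" using M by (rule mult_left_mono)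
      ultimately show ?thesis unfolding f_def by (simp add: algebra_simps)
    qed
    have W: "u a - u b \<le> W" if "norm (a - x) \<le> \<epsilon>" "norm (b - y) \<le> \<epsilon>" for a b
      using H[of a b] Gf[of a b] fW[OF that] by (simp add: W_def)
    have zw: "avg p \<epsilon> z u x - avg p \<epsilon> w u y \<le> W"
      by (rule avg_diff_le_const[OF u_meas u_bound z \<epsilon>(1) W])
    \<comment> \<open>The adversary's half is at most \<open>W\<close>, so a gain \<open>q\<close>
      in the other half counts half.\<close>
    have half: "a \<le> W - q / 2 + 3 * \<epsilon>\<^sup>2"
      if "b \<le> W - q" "a \<le> d / 2 + b / 2 + 3 * \<epsilon>\<^sup>2" "d \<le> W" for a b d q
      using that by (simp add: field_simps)
    consider "K * \<epsilon> \<le> t" | "t < K * \<epsilon>" "\<epsilon>/2 \<le> t" | "t \<le> \<epsilon>/2" by linarith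
    then show ?thesis
    proof cases
      case 1
      have "0 < K * \<epsilon>" using K \<epsilon> by simp
      then have tp: "0 < t" using 1 by linarith
      \<comment> \<open>The cutoff \<open>K = 64 / c\<^sup>2\<close> makes
        \<open>K * \<epsilon> \<le> t\<close> exactly this smallness condition.\<close>
      have \<epsilon>t: "64 * \<epsilon> \<le> (drift TYPE('n))\<^sup>2 * t"
        using 1 c2 by (simp add: K_def field_simps flip: c_def)
      \<comment> \<open>The number 388 in \<open>C\<close> is \<open>3 * M + 4\<close> for
        \<open>M = 128\<close>.\<close>
      have CM: "64 * (3 * M + 4) \<le> C * (drift TYPE('n))\<^sup>2"
        using c by (simp add: C_def M_def flip: c_def)
      have "K \<le> t / \<epsilon>" using 1 \<epsilon> by (simp add: field_simps)
      then have "G x y = f x y" by (simp add: G_def g_def step_penalty_def flip: t_def)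
      moreover have "u x - u y \<le> \<theta> - \<epsilon>\<^sup>2 + C * sqrt t + M * (norm (x - x\<^sub>0))\<^sup>2"
      proof (rule large_distance_step[OF u_meas u_bound e z xy tp _ \<epsilon>(1) \<epsilon>t _ M CM _ dpp'])
        show "u a - u b \<le> \<theta> + C * sqrt (norm (a - b)) + M * (norm (a - x\<^sub>0))\<^sup>2" for a b
          using H[of a b] Gf[of a b] by (simp add: f_def)
      qed (use near in auto)
      ultimately show ?thesis by (simp add: f_def flip: t_def)
    next
      case 2
      define s where "s = t / \<epsilon>"
      have s: "s < K" using 2 \<epsilon> by (simp add: s_def field_simps)
      define r where "r = sqrt \<epsilon> * g (s - 1/4)"
      have r0: "0 \<le> r" using g0 se by (simp add: r_def)
      have "avg p \<epsilon> (- e) u x - avg p \<epsilon> e u y \<le> W - pull TYPE('n) * r"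
      proof (rule avg_diff_le_pull[OF u_meas u_bound e \<epsilon>(1) W xy 2(2) r0])
        fix a b :: "real ^ 'n"
        assume ab: "norm (a - x) \<le> \<epsilon>" "norm (b - y) \<le> \<epsilon>" "norm (a - b) \<le> t - \<epsilon>/4"
        have "norm (a - b) / \<epsilon> \<le> s - 1/4" using ab(3) \<epsilon> by (simp add: s_def field_simps)
        then have "r \<le> sqrt \<epsilon> * g (norm (a - b) / \<epsilon>)"
          unfolding r_def using g_anti se by (intro mult_left_mono) auto
        then show "u a - u b \<le> W - r" using H[of a b] fW[OF ab(1,2)] by (simp add: W_def G_def)
      qed
      then have "u x - u y \<le> W - (\<kappa> * r) / 2 + 3 * \<epsilon>\<^sup>2" unfolding \<kappa>_def by (rule half[OF _ dpp'[OF e' e] zw])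
      \<comment> \<open>As \<open>\<kappa> * \<rho> = 4\<close>, the halved pull gain is twice
        \<open>sqrt \<epsilon> * g s\<close>: one copy is the correction in \<open>G x y\<close>,
        the other pays for all errors through \<open>A \<le> g s\<close>.\<close>
      also have "g (s - 1/4) = \<rho> * g s" "A \<le> g s" using step_penalty_shift[of A \<rho> s K] A \<rho> s by (auto simp: g_def)
      then have "\<kappa> * r = sqrt \<epsilon> * ((\<kappa> * \<rho>) * g s)" by (simp add: r_def)
      also have "W - sqrt \<epsilon> * ((\<kappa> * \<rho>) * g s) / 2 + 3 * \<epsilon>\<^sup>2 = W - 2 * (sqrt \<epsilon> * g s) + 3 * \<epsilon>\<^sup>2" unfolding \<rho>(2) by simp
      also have "\<dots> \<le> \<theta> - \<epsilon>\<^sup>2 + G x y"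
        using mult_left_mono[OF \<open>A \<le> g s\<close>, of "sqrt \<epsilon>"] se e2
        by (simp add: W_def G_def s_def A_def algebra_simps flip: t_def)
      finally show ?thesis .
    next
      case 3
      have "avg p \<epsilon> e u x - avg p \<epsilon> e u y \<le> (1 - \<beta>) * W"
        unfolding \<beta>_def by (rule avg_diff_le_overlap[OF u_meas u_bound e \<epsilon>(1) xy t0 3 W])
      also have "\<dots> = W - \<beta> * W" by (simp add: left_diff_distrib)
      finally have "u x - u y \<le> W - \<beta> * W / 2 + 3 * \<epsilon>\<^sup>2" by (rule half[OF _ dpp'[OF e e] zw])
      \<comment> \<open>Since \<open>\<theta>\<close>, and with it \<open>W\<close>, is at least
        \<open>\<Theta> * sqrt \<epsilon>\<close>, the overlap gain pays for the errors and for the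
        largest correction \<open>g 0\<close>.\<close>
      moreover have "(A + g 0) * sqrt \<epsilon> \<le> \<beta> * W / 2"
      proof -
        have "(A + g 0) * sqrt \<epsilon> \<le> (\<beta> * \<Theta> / 2) * sqrt \<epsilon>" using \<Theta>2 se by (intro mult_right_mono) auto
        also have "\<dots> = \<beta> / 2 * (\<Theta> * sqrt \<epsilon>)" by simp
        also have "\<Theta> * sqrt \<epsilon> \<le> W" using \<theta> f0[of x y] C M se by (simp add: W_def add_increasing2)
        finally show ?thesis using \<beta> by simp
      qed
      moreover have "(A + g 0) * sqrt \<epsilon> = (2 * C + 3 * M) * sqrt \<epsilon> + 4 * sqrt \<epsilon> + sqrt \<epsilon> * g 0"
        by (simp add: A_def algebra_simps)
      moreover have "a \<le> \<theta> - \<epsilon>\<^sup>2 + (f x y - k)"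
        if "a \<le> W - X + 3 * \<epsilon>\<^sup>2" "m \<le> X" "m = (2 * C + 3 * M) * sqrt \<epsilon> + 4 * sqrt \<epsilon> + k'" "k \<le> k'" for a k k' m X
        using that e2 unfolding W_def by linarith
      ultimately show ?thesis unfolding G_def using gG[of x y] by blast
    qed
  qed
  \<comment> \<open>The least admissible excess. The supremum may fail to be attained;
    \<open>step\<close> lowers it by the fixed amount \<open>\<epsilon>\<^sup>2\<close>, which is
    enough for a contradiction.\<close>
  define S where "S = (SUP (a, b)\<in>UNIV. u a - u b - G a b)"
  have bdd: "bdd_above (range (\<lambda>(a, b). u a - u b - G a b))"
  proof (rule bdd_aboveI[where M = "2 + sqrt \<epsilon> * g 0"])
    fix v assume "v \<in> range (\<lambda>(a, b). u a - u b - G a b)"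
    then obtain a b where "v = u a - u b - G a b" by auto
    then show "v \<le> 2 + sqrt \<epsilon> * g 0"
      using gG[of a b] f0[of a b] u_bound[of a] u_bound[of b] unfolding G_def by linarith
  qed
  have S: "u a - u b \<le> S + G a b" for a b
    using cSUP_upper[OF _ bdd, of "(a, b)"] by (simp add: S_def)
  have "S \<le> \<Theta> * sqrt \<epsilon>"
  proof (rule ccontr)
    assume "\<not> S \<le> \<Theta> * sqrt \<epsilon>"
    then have "u a - u b - G a b \<le> S - \<epsilon>\<^sup>2" for a b using step[OF _ S, of a b] by simp
    then have "S \<le> S - \<epsilon>\<^sup>2" unfolding S_def by (intro cSUP_least) auto
    then show False using \<epsilon> by simp
  qed
  then show ?thesis using S[of x\<^sub>0 y\<^sub>0] Gf[of x\<^sub>0 y\<^sub>0] by (simp add: f_def)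
qed

end

text \<open>The vectors \<open>z\<close> and \<open>w\<close> nearly attain \<open>Sup F\<close> and
  \<open>Inf G\<close>, each with a loss of \<open>\<eta>\<close> that is then halved, while
  \<open>Inf F\<close> and \<open>Sup G\<close> admit arbitrary \<open>z'\<close> and
  \<open>w'\<close>. This yields the adversary's pair and the free answer.\<close>

lemma sup_inf_difference_le:
  fixes F G :: "'a \<Rightarrow> real"
  assumes Z: "Z \<noteq> {}" and F: "\<And>z. z \<in> Z \<Longrightarrow> \<bar>F z\<bar> \<le> B" and G: "\<And>z. z \<in> Z \<Longrightarrow> \<bar>G z\<bar> \<le> B" and \<eta>: "0 < \<eta>"
  shows "\<exists>z\<in>Z. \<exists>w\<in>Z. \<forall>z'\<in>Z. \<forall>w'\<in>Z.
    1/2 * (Sup (F ` Z) + Inf (F ` Z)) - 1/2 * (Sup (G ` Z) + Inf (G ` Z))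
      \<le> (F z - G w) / 2 + (F z' - G w') / 2 + \<eta>"
proof -
  have bF: "bdd_above (F ` Z)" "bdd_below (F ` Z)"
    using F by (auto intro!: bdd_aboveI2[where M = B] bdd_belowI2[where m = "- B"] simp: abs_le_iff)
      (metis minus_le_iff)+
  have bG: "bdd_above (G ` Z)" "bdd_below (G ` Z)"
    using G by (auto intro!: bdd_aboveI2[where M = B] bdd_belowI2[where m = "- B"] simp: abs_le_iff)
      (metis minus_le_iff)+
  obtain z where z: "z \<in> Z" "Sup (F ` Z) - \<eta> < F z"
    using less_cSUP_iff[OF Z bF(1), of "Sup (F ` Z) - \<eta>"] \<eta> by auto
  obtain w where w: "w \<in> Z" "G w < Inf (G ` Z) + \<eta>"
    using cINF_less_iff[OF Z bG(2), of "Inf (G ` Z) + \<eta>"] \<eta> by auto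
  show ?thesis
  proof (rule bexI[OF _ z(1)], rule bexI[OF _ w(1)], intro ballI)
    fix z' w' assume "z' \<in> Z" "w' \<in> Z"
    then show "1/2 * (Sup (F ` Z) + Inf (F ` Z)) - 1/2 * (Sup (G ` Z) + Inf (G ` Z))
      \<le> (F z - G w) / 2 + (F z' - G w') / 2 + \<eta>"
      using cINF_lower[OF bF(2), of z'] cSUP_upper[OF _ bG(1), of w'] z(2) w(2)
      by (simp add: field_simps)
  qed
qed

section \<open>Rescaling to the unit ball\<close>

context singular_exponent
begin

lemma abs_avg_le:
  fixes u :: "real ^ 'n \<Rightarrow> real"
  assumes u: "u \<in> borel_measurable borel" "\<And>x. \<bar>u x\<bar> \<le> 1" and z: "norm z = 1"
  shows "\<bar>avg p \<epsilon> z u x\<bar> \<le> 1"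
proof -
  have i: "integrable (step_measure p z) (\<lambda>h. u (x + \<epsilon> *\<^sub>R h))"
    using shift_integrable[OF u z, of "\<lambda>h. h"] by simp
  have c: "integrable (step_measure p z) (\<lambda>h. a)" for a :: real
    by (rule finite_measure.integrable_const[OF finite_step_measure[OF z]])
  have u': "u y \<le> 1" "- 1 \<le> u y" for y using u(2)[of y] by linarith+
  have "avg p \<epsilon> z u x \<le> (\<integral>h. 1 \<partial>step_measure p z)"
    unfolding avg_def by (rule step_integral_mono[OF z i c u'(1)])
  moreover have "(\<integral>h. - 1 \<partial>step_measure p z) \<le> avg p \<epsilon> z u x"
    unfolding avg_def by (rule step_integral_mono[OF z c i u'(2)])
  ultimately have "avg p \<epsilon> z u x \<le> 1" "- 1 \<le> avg p \<epsilon> z u x"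
    unfolding integral_step_measure_const[OF z] .
  then show ?thesis by linarith
qed

text \<open>The volume of the unit ball cancels, as \<open>norm_const\<close> is \<open>mass\<close>
  divided by it. The factor \<open>a\<close> and the second radius allow \<open>v\<close> to be a
  rescaled copy of \<open>u\<close> within reach of a step.\<close>

lemma dir_avg_eq:
  fixes z x :: "real ^ 'n"
  assumes z: "norm z = 1" and v: "v \<in> borel_measurable borel"
    and uv: "\<And>h. norm h < 1 \<Longrightarrow> u (X + \<epsilon> *\<^sub>R h) = a * v (x + \<epsilon>' *\<^sub>R h)"
  shows "dir_avg p \<epsilon> z u X = a * avg p \<epsilon>' z v x"
proof -
  define m where "m = measure lborel (ball (0 :: real ^ 'n) 1)"
  have m: "0 < m" unfolding m_def by (rule measure_lborel_ball_pos) simp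
  have nc: "norm_const p z = 1 / m * mass p z"
    by (simp add: norm_const_def set_lebesgue_integral_def mass_def weight_def m_def)
  have [measurable]: "(\<lambda>h. v (x + \<epsilon>' *\<^sub>R h)) \<in> borel_measurable borel" using v by measurable
  have "(LINT h : ball 0 1 | lborel. u (X + \<epsilon> *\<^sub>R h) * pos_pow p (z \<bullet> h))
    = (LINT h|lborel. a * (weight p z h * v (x + \<epsilon>' *\<^sub>R h)))"
    unfolding set_lebesgue_integral_def
    by (rule Bochner_Integration.integral_cong[OF refl]) (simp add: weight_def uv indicator_def)
  also have "\<dots> = a * (LINT h|lborel. weight p z h * v (x + \<epsilon>' *\<^sub>R h))" by simp
  finally show ?thesis
    using m unfolding dir_avg_def nc avg_def by (simp add: integral_step_measure flip: m_def)
qed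

text \<open>Dilation by \<open>R\<close> and division by \<open>S\<close> give a function bounded by
  1, with step \<open>\<epsilon> / R\<close> and source term at most the square of that step, as
  \<open>comparison\<close> requires.\<close>

lemma scaled_estimate:
  fixes u f :: "real ^ 'n \<Rightarrow> real" and C K A \<Theta> R \<epsilon> :: real
  defines "C \<equiv> 64 * 388 / (drift TYPE('n))\<^sup>2" and "K \<equiv> 64 / (drift TYPE('n))\<^sup>2"
  defines "A \<equiv> 2 * C + 3 * 128 + 4"
  defines "\<Theta> \<equiv> (2 / overlap TYPE('n) + 1) * (A + step_penalty A (4 / pull TYPE('n)) K 0)"
  assumes R: "0 < R" and \<epsilon>: "0 < \<epsilon>" "\<epsilon> < 1 / (8 * K) * R"
    and u: "bounded_borel_on (ball 0 (R + \<epsilon>)) u" and S: "0 < S"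
    and uS: "\<And>x. x \<in> ball 0 R \<Longrightarrow> \<bar>u x\<bar> \<le> S" and fS: "\<And>x. x \<in> ball 0 R \<Longrightarrow> R\<^sup>2 * \<bar>f x\<bar> \<le> S"
    and dpp: "\<And>x. x \<in> ball 0 R \<Longrightarrow>
      u x = 1 / 2 * ((SUP z \<in> {z. norm z = 1}. dir_avg p \<epsilon> z u x) +
                     (INF z \<in> {z. norm z = 1}. dir_avg p \<epsilon> z u x)) + \<epsilon>\<^sup>2 * f x"
    and xy: "x \<in> ball 0 (R / 2)" "y \<in> ball 0 (R / 2)"
  shows "u x - u y \<le> S * (\<Theta> * sqrt (\<epsilon> / R) + C * sqrt (norm (x - y) / R))"
proof -
  \<comment> \<open>The bound \<open>S\<close> is known on the ball of radius \<open>R\<close> only,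
    so \<open>v\<close> is set to 0 outside the unit ball to be bounded by 1 everywhere.\<close>
  define v where "v x = (if x \<in> ball 0 1 then u (R *\<^sub>R x) / S else 0)" for x
  define e where "e = \<epsilon> / R"
  have e: "0 < e" "e \<le> 1 / (8 * K)" using R \<epsilon> by (auto simp: e_def field_simps)
  have "(drift TYPE('n))\<^sup>2 \<le> 1" using drift_bounds[where 'n = 'n] by (intro power_le_one) auto
  then have "1 / (8 * K) \<le> 1/8" by (simp add: K_def)
  then have e8: "e \<le> 1/8" using e by simp
  have RX: "R *\<^sub>R x \<in> ball 0 R \<longleftrightarrow> x \<in> ball 0 1" for x :: "real ^ 'n" using R by simp
  have v_bound: "\<bar>v x\<bar> \<le> 1" for x
    using uS[of "R *\<^sub>R x"] RX[of x] S by (simp add: v_def)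
  have "(\<lambda>x. indicator (ball 0 (R + \<epsilon>)) x *\<^sub>R u x) \<in> borel_measurable borel"
    using u unfolding bounded_borel_on_def by (subst (asm) borel_measurable_restrict_space_iff) auto
  then have u_meas: "(\<lambda>x. indicator (ball 0 (R + \<epsilon>)) (R *\<^sub>R x) *\<^sub>R u (R *\<^sub>R x)) \<in> borel_measurable borel"
    by (rule measurable_compose[rotated]) simp
  have "v = (\<lambda>x. indicator (ball 0 1) x * (indicator (ball 0 (R + \<epsilon>)) (R *\<^sub>R x) *\<^sub>R u (R *\<^sub>R x)) / S)"
  proof
    fix x :: "real ^ 'n"
    have "R *\<^sub>R x \<in> ball 0 (R + \<epsilon>)" if "x \<in> ball 0 1" using RX[of x] that \<epsilon>(1) by (simp add: add_strict_increasing)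
    then show "v x = indicator (ball 0 1) x * (indicator (ball 0 (R + \<epsilon>)) (R *\<^sub>R x) *\<^sub>R u (R *\<^sub>R x)) / S"
      by (cases "x \<in> ball 0 1") (simp_all add: v_def)
  qed
  moreover have "\<dots> \<in> borel_measurable borel"
    by (intro borel_measurable_divide borel_measurable_times borel_measurable_indicator u_meas) simp_all
  ultimately have v_meas: "v \<in> borel_measurable borel" by (simp only:)
  \<comment> \<open>A step shorter than 1/8 from the ball of radius 7/8 stays in the unit ball,
    where \<open>v\<close> is not cut off.\<close>
  have avg: "dir_avg p \<epsilon> z u (R *\<^sub>R x) = S * avg p e z v x" if "norm z = 1" "x \<in> ball 0 (7/8)" for x z :: "real ^ 'n"
  proof (rule dir_avg_eq[OF that(1) v_meas])
    fix h :: "real ^ 'n" assume h: "norm h < 1"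
    have "norm (x + e *\<^sub>R h) \<le> norm x + e * norm h" using norm_triangle_ineq[of x "e *\<^sub>R h"] e by simp
    also have "\<dots> < 7/8 + 1/8 * 1"
      using that(2) h e e8 by (intro add_less_le_mono mult_mono) auto
    finally have "x + e *\<^sub>R h \<in> ball 0 1" by simp
    then have "S * v (x + e *\<^sub>R h) = u (R *\<^sub>R (x + e *\<^sub>R h))" using S by (simp add: v_def)
    also have "R *\<^sub>R (x + e *\<^sub>R h) = R *\<^sub>R x + \<epsilon> *\<^sub>R h" using R by (simp add: e_def scaleR_add_right)
    finally show "u (R *\<^sub>R x + \<epsilon> *\<^sub>R h) = S * v (x + e *\<^sub>R h)" ..
  qed
  have Z: "{z :: real ^ 'n. norm z = 1} \<noteq> {}" using norm_axis_1[of undefined] by blast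
  have v_dpp: "\<exists>z w. norm z = 1 \<and> norm w = 1 \<and> (\<forall>z' w'. norm z' = 1 \<longrightarrow> norm w' = 1 \<longrightarrow>
      v x - v y \<le> (avg p e z v x - avg p e w v y) / 2 + (avg p e z' v x - avg p e w' v y) / 2 + 3 * e\<^sup>2)"
    if x: "x \<in> ball 0 (7/8)" and y: "y \<in> ball 0 (7/8)" for x y
  proof -
    let ?Z = "{z :: real ^ 'n. norm z = 1}"
    have x1: "x \<in> ball 0 1" "y \<in> ball 0 1" using x y by auto
    have bound: "\<bar>S * avg p e z v w\<bar> \<le> S" if "z \<in> ?Z" for z w
      using abs_avg_le[OF v_meas v_bound, of z e w] that S by (simp add: abs_mult mult_left_le)
    \<comment> \<open>The loss from near-optimal directions is taken as
      \<open>S * e\<^sup>2\<close>, the size of one source term; with the source terms at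
      \<open>x\<close> and \<open>y\<close> this makes \<open>3 * e\<^sup>2\<close> after division
      by \<open>S\<close>.\<close>
    obtain z w where zw: "z \<in> ?Z" "w \<in> ?Z"
      and le: "\<And>z' w'. z' \<in> ?Z \<Longrightarrow> w' \<in> ?Z \<Longrightarrow>
        1/2 * ((SUP z\<in>?Z. S * avg p e z v x) + (INF z\<in>?Z. S * avg p e z v x))
        - 1/2 * ((SUP z\<in>?Z. S * avg p e z v y) + (INF z\<in>?Z. S * avg p e z v y))
        \<le> (S * avg p e z v x - S * avg p e w v y) / 2 + (S * avg p e z' v x - S * avg p e w' v y) / 2 + S * e\<^sup>2"
      using sup_inf_difference_le[where F = "\<lambda>z. S * avg p e z v x" and G = "\<lambda>z. S * avg p e z v y"
          and \<eta> = "S * e\<^sup>2", OF Z bound bound] S e by auto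
    have eq: "S * v x = 1/2 * ((SUP z\<in>?Z. S * avg p e z v x) + (INF z\<in>?Z. S * avg p e z v x)) + \<epsilon>\<^sup>2 * f (R *\<^sub>R x)"
      if "x \<in> ball 0 (7/8)" for x
    proof -
      have x1: "x \<in> ball 0 1" using that by auto
      have "S * v x = u (R *\<^sub>R x)" using S x1 by (simp add: v_def)
      also have "\<dots> = 1/2 * ((SUP z\<in>?Z. dir_avg p \<epsilon> z u (R *\<^sub>R x)) + (INF z\<in>?Z. dir_avg p \<epsilon> z u (R *\<^sub>R x))) + \<epsilon>\<^sup>2 * f (R *\<^sub>R x)"
        by (rule dpp) (use RX x1 in blast)
      also have "(SUP z\<in>?Z. dir_avg p \<epsilon> z u (R *\<^sub>R x)) = (SUP z\<in>?Z. S * avg p e z v x)"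
        by (intro SUP_cong refl avg that) simp
      also have "(INF z\<in>?Z. dir_avg p \<epsilon> z u (R *\<^sub>R x)) = (INF z\<in>?Z. S * avg p e z v x)"
        by (intro INF_cong refl avg that) simp
      finally show ?thesis .
    qed
    have fe: "\<bar>\<epsilon>\<^sup>2 * f (R *\<^sub>R x)\<bar> \<le> S * e\<^sup>2" if "x \<in> ball 0 1" for x
    proof -
      have "e\<^sup>2 * (R\<^sup>2 * \<bar>f (R *\<^sub>R x)\<bar>) \<le> e\<^sup>2 * S" using fS[of "R *\<^sub>R x"] RX that by (intro mult_left_mono) auto
      moreover have "\<bar>\<epsilon>\<^sup>2 * f (R *\<^sub>R x)\<bar> = e\<^sup>2 * (R\<^sup>2 * \<bar>f (R *\<^sub>R x)\<bar>)"
        using R by (simp add: e_def power_divide abs_mult)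
      ultimately show ?thesis by (simp only: mult.commute)
    qed
    show ?thesis
    proof (rule exI[of _ z], rule exI[of _ w], intro conjI allI impI)
      fix z' w' :: "real ^ 'n" assume "norm z' = 1" "norm w' = 1"
      then have "S * v x - S * v y \<le> (S * avg p e z v x - S * avg p e w v y) / 2
          + (S * avg p e z' v x - S * avg p e w' v y) / 2 + S * e\<^sup>2 + 2 * (S * e\<^sup>2)"
        using le[of z' w'] fe[OF x1(1)] fe[OF x1(2)] eq[OF x] eq[OF y] by simp
      also have "\<dots> = S * ((avg p e z v x - avg p e w v y) / 2 + (avg p e z' v x - avg p e w' v y) / 2 + 3 * e\<^sup>2)"
        by (simp add: algebra_simps)
      finally have "S * (v x - v y) \<le> S * ((avg p e z v x - avg p e w v y) / 2 + (avg p e z' v x - avg p e w' v y) / 2 + 3 * e\<^sup>2)"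
        by (simp add: algebra_simps)
      then show "v x - v y \<le> (avg p e z v x - avg p e w v y) / 2 + (avg p e z' v x - avg p e w' v y) / 2 + 3 * e\<^sup>2"
        using S by simp
    qed (use zw in auto)
  qed
  let ?x = "(1/R) *\<^sub>R x" and ?y = "(1/R) *\<^sub>R y"
  have "?x \<in> ball 0 (1/2)" using xy R by (simp add: field_simps)
  then have "v ?x - v ?y \<le> \<Theta> * sqrt e + C * sqrt (norm (?x - ?y))"
    unfolding \<Theta>_def A_def C_def K_def
    by (rule comparison[OF v_meas v_bound e[unfolded K_def] _ v_dpp])
  moreover have "norm (?x - ?y) = norm (x - y) / R" using R by (simp flip: scaleR_diff_right)
  moreover have "v ?x = u x / S" "v ?y = u y / S" using xy R by (auto simp: v_def field_simps)
  ultimately have "(u x - u y) / S \<le> \<Theta> * sqrt (\<epsilon> / R) + C * sqrt (norm (x - y) / R)"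
    by (simp add: e_def diff_divide_distrib)
  then show ?thesis using S by (simp add: field_simps)
qed

end

section \<open>Choice of the constants and conclusion\<close>

theorem corollary4p3:
  fixes p :: real
  assumes "1 < p" and "p < 2"
  shows "\<exists>\<epsilon>\<^sub>0 C \<gamma> :: real. \<epsilon>\<^sub>0 > 0 \<and> C > 0 \<and> \<gamma> > 0 \<and>
    (\<forall>R \<epsilon> (f :: real ^ 'n \<Rightarrow> real) (u :: real ^ 'n \<Rightarrow> real).
       R > 0 \<longrightarrow> 0 < \<epsilon> \<longrightarrow> \<epsilon> < \<epsilon>\<^sub>0 * R \<longrightarrow>
       bounded_borel_on (ball 0 R) f \<longrightarrow>
       bounded_borel_on (ball 0 (R + \<epsilon>)) u \<longrightarrow>
       (\<forall>x \<in> ball 0 R.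
          u x = 1 / 2 * ((SUP z \<in> {z. norm z = 1}. dir_avg p \<epsilon> z u x) +
                         (INF z \<in> {z. norm z = 1}. dir_avg p \<epsilon> z u x)) + \<epsilon>\<^sup>2 * f x) \<longrightarrow>
       (\<forall>x \<in> ball 0 (R / 2). \<forall>y \<in> ball 0 (R / 2).
          \<bar>u x - u y\<bar> \<le>
            C / R powr \<gamma> * ((SUP w \<in> ball 0 R. \<bar>u w\<bar>) + R\<^sup>2 * (SUP w \<in> ball 0 R. \<bar>f w\<bar>)) *
            (norm (x - y) powr \<gamma> + \<epsilon> powr \<gamma>)))"
proof -
  interpret singular_exponent p using assms by unfold_locales
  define C where "C = 64 * 388 / (drift TYPE('n))\<^sup>2"
  define K where "K = 64 / (drift TYPE('n))\<^sup>2"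
  define A where "A = 2 * C + 3 * 128 + 4"
  define \<Theta> where "\<Theta> = (2 / overlap TYPE('n) + 1) * (A + step_penalty A (4 / pull TYPE('n)) K 0)"
  have K: "0 < K" and C: "0 < C" using drift_bounds[where 'n = 'n] by (auto simp: K_def C_def)
  have A: "0 < A" using C by (simp add: A_def)
  have \<Theta>: "0 \<le> \<Theta>"
    unfolding \<Theta>_def using overlap_pos[where 'n = 'n] A step_penalty_nonneg[of A] by simp
  have main: "\<bar>u x - u y\<bar> \<le> (\<Theta> + C) / R powr (1/2) *
        ((SUP w \<in> ball 0 R. \<bar>u w\<bar>) + R\<^sup>2 * (SUP w \<in> ball 0 R. \<bar>f w\<bar>)) *
        (norm (x - y) powr (1/2) + \<epsilon> powr (1/2))"
    if R: "0 < R" and \<epsilon>: "0 < \<epsilon>" "\<epsilon> < 1 / (8 * K) * R"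
      and f: "bounded_borel_on (ball 0 R) f" and u: "bounded_borel_on (ball 0 (R + \<epsilon>)) u"
      and dpp: "\<forall>x \<in> ball 0 R. u x = 1 / 2 * ((SUP z \<in> {z. norm z = 1}. dir_avg p \<epsilon> z u x) +
                         (INF z \<in> {z. norm z = 1}. dir_avg p \<epsilon> z u x)) + \<epsilon>\<^sup>2 * f x"
      and xy: "x \<in> ball 0 (R / 2)" "y \<in> ball 0 (R / 2)"
    for R \<epsilon> and f u :: "real ^ 'n \<Rightarrow> real" and x y
  proof -
    define S\<^sub>u where "S\<^sub>u = (SUP w \<in> ball 0 R. \<bar>u w\<bar>)"
    define S\<^sub>f where "S\<^sub>f = (SUP w \<in> ball 0 R. \<bar>f w\<bar>)"
    define S where "S = S\<^sub>u + R\<^sup>2 * S\<^sub>f"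
    have sub: "ball (0 :: real ^ 'n) R \<subseteq> ball 0 (R + \<epsilon>)" using \<epsilon> by (intro subset_ball) simp
    have bdd: "bdd_above ((\<lambda>w. \<bar>g w\<bar>) ` ball 0 R)" if "bounded (g ` ball 0 R)" for g :: "real ^ 'n \<Rightarrow> real"
      using that unfolding bounded_iff bdd_above_def by auto
    have Su: "\<bar>u w\<bar> \<le> S\<^sub>u" if "w \<in> ball 0 R" for w
      unfolding S\<^sub>u_def using u that sub
      by (intro cSUP_upper bdd) (auto simp: bounded_borel_on_def intro: bounded_subset)
    have Sf: "\<bar>f w\<bar> \<le> S\<^sub>f" if "w \<in> ball 0 R" for w
      unfolding S\<^sub>f_def using f that by (intro cSUP_upper bdd) (auto simp: bounded_borel_on_def)
    have "(0 :: real ^ 'n) \<in> ball 0 R" using R by simp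
    then have S0: "0 \<le> S\<^sub>u" "0 \<le> S\<^sub>f" using Su[of 0] Sf[of 0] by linarith+
    have RSf: "0 \<le> R\<^sup>2 * S\<^sub>f" using S0 by simp
    have xyR: "x \<in> ball 0 R" "y \<in> ball 0 R" using xy R by auto
    have sq: "a powr (1/2) = sqrt a" if "0 \<le> a" for a :: real using that by (simp add: powr_half_sqrt)
    have "\<bar>u x - u y\<bar> \<le> (\<Theta> + C) / sqrt R * S * (sqrt (norm (x - y)) + sqrt \<epsilon>)"
    proof (cases "S = 0")
      \<comment> \<open>Scaling divides by \<open>S\<close>. If \<open>S = 0\<close>, then
        \<open>u\<close> vanishes on the ball and both sides are 0.\<close>
      case True
      then have "S\<^sub>u = 0" using S0 RSf unfolding S_def by linarith
      then show ?thesis using Su[OF xyR(1)] Su[OF xyR(2)] True by simp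
    next
      case False
      then have S: "0 < S" using S0 RSf unfolding S_def by linarith
      have uS: "\<bar>u w\<bar> \<le> S" if "w \<in> ball 0 R" for w using Su[OF that] RSf by (simp add: S_def)
      have fS: "R\<^sup>2 * \<bar>f w\<bar> \<le> S" if "w \<in> ball 0 R" for w
        using mult_left_mono[OF Sf[OF that], of "R\<^sup>2"] S0 by (simp add: S_def)
      have "u x - u y \<le> S * (\<Theta> * sqrt (\<epsilon> / R) + C * sqrt (norm (x - y) / R))"
        if "x \<in> ball 0 (R / 2)" "y \<in> ball 0 (R / 2)" for x y
        unfolding \<Theta>_def A_def C_def K_def
        by (rule scaled_estimate[OF R \<epsilon>[unfolded K_def] u S uS fS _ that]) (use dpp in auto)
      from this[OF xy] this[OF xy(2,1)]
      have "\<bar>u x - u y\<bar> \<le> S * (\<Theta> * sqrt (\<epsilon> / R) + C * sqrt (norm (x - y) / R))"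
        by (simp add: abs_le_iff norm_minus_commute)
      also have "\<dots> = S / sqrt R * (\<Theta> * sqrt \<epsilon> + C * sqrt (norm (x - y)))"
        by (simp add: real_sqrt_divide add_divide_distrib distrib_left)
      also have "\<dots> \<le> S / sqrt R * ((\<Theta> + C) * (sqrt (norm (x - y)) + sqrt \<epsilon>))"
      proof (rule mult_left_mono)
        have "0 \<le> \<Theta> * sqrt (norm (x - y))" "0 \<le> C * sqrt \<epsilon>" using \<Theta> C \<epsilon> by auto
        then show "\<Theta> * sqrt \<epsilon> + C * sqrt (norm (x - y)) \<le> (\<Theta> + C) * (sqrt (norm (x - y)) + sqrt \<epsilon>)"
          by (simp add: algebra_simps)
      qed (use S R in auto)
      finally show ?thesis by (simp add: mult_ac)
    qed
    then show ?thesis using R \<epsilon> by (simp add: sq S_def S\<^sub>u_def S\<^sub>f_def)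
  qed
  show ?thesis
    \<comment> \<open>The first witness is the bound that \<open>comparison\<close> puts on the
      rescaled step \<open>\<epsilon> / R\<close>; the exponent 1/2 is that of the square root in
      the comparison function.\<close>
    by (rule exI[of _ "1 / (8 * K)"], rule exI[of _ "\<Theta> + C"], rule exI[of _ "1/2"])
      (use K C \<Theta> main in \<open>auto simp del: mem_ball\<close>)
qed

end
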